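(* Let $T\colon X\to X$ be a transitive expanding covering map on a compact metric space $(X,d)$, and let $A\colon X\to\mathbb{R}$ be $\alpha$-Hölder continuous with $\alpha\in(0,1]$. If the family of equilibrium states $\{\mu_{\beta A}\}_{\beta\in(1,+\infty)}$ satisfies the large deviation principle as $\beta\to+\infty$, then the following statements are true: (i) $\{g_\beta/\beta\}_{\beta\in(1,+\infty)}$ uniformly converges as $\beta\to+\infty$, where $g_\beta:=\beta A+\log u_{\beta A}-\log u_{\beta A}\circ T-P(T,\beta A)$. (ii) $\{\frac1\beta\log u_{\beta A}\}_{\beta\in(1,+\infty)}$ uniformly converges as $\beta\to+\infty$. (iii) $\{l_\beta^m(\cdot)\}_{\beta\in(1,+\infty)}$ uniformly converges on every compact subset of $C(X,\mathbb{R})$ as $\beta\to+\infty$. Conversely, if both statements (ii) and (iii) are true, then $\{\mu_{\beta A}\}_{\beta\in(1,+\infty)}$ satisfies the large deviation principle as $\beta\to+\infty$.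
   Context: A map $T$ on a metric space $(X,d)$ is distance-expanding if there exist $\lambda>1$, $\eta>0$ such that $d(x,y)\le2\eta$ implies $d(Tx,Ty)\ge\lambda d(x,y)$. A covering map is an open, continuous, surjective local homeomorphism $T\colon X\to X$; an expanding covering map is a covering map that is distance-expanding. Transitive means topologically transitive. $C(X,\mathbb{R})$ carries the uniform norm. For $\varphi\in C(X,\mathbb{R})$ the Ruelle operator is $\mathcal{R}_\varphi(u)(x)=\sum_{y\in T^{-1}(x)}u(y)e^{\varphi(y)}$, $u\in C(X,\mathbb{R})$, with adjoint $\mathcal{R}_\varphi^*$ on Borel measures. $P(T,\varphi)$ denotes the topological pressure, i.e. the maximum of $h_\mu(T)+\int\varphi\,\mathrm{d}\mu$ over $T$-invariant Borel probability measures $\mu$; maximizers are called equilibrium states. For $\beta>0$, $m_{\beta A}$ is the unique Borel probability measure with $\mathcal{R}_{\beta A}^*(m_{\beta A})=e^{P(T,\beta A)}m_{\beta A}$; $u_{\beta A}\in C(X,\mathbb{R})$ is the unique (strictly positive) function with $\mathcal{R}_{\beta A}(u_{\beta A})=e^{P(T,\beta A)}u_{\beta A}$ and $\int_X u_{\beta A}\,\mathrm{d}m_{\beta A}=1$; and $\mu_{\beta A}=u_{\beta A}\cdot m_{\beta A}$ is the unique equilibrium state for $\beta A$. (Existence and uniqueness are well known in this setting.) For $f\in C(X,\mathbb{R})$, $l_\beta^m(f)=\frac1\beta\log\int e^{\beta f}\,\mathrm{d}m_{\beta A}$. A family of Borel probability measures $\{\nu_\beta\}_{\beta\in(1,+\infty)}$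 on $X$ satisfies the large deviation principle as $\beta\to+\infty$ if there exists a lower semi-continuous $I\colon X\to[0,+\infty]$ such that $\liminf_{\beta\to+\infty}\frac1\beta\log\nu_\beta(G)\ge-\inf_{x\in G}I(x)$ for every open $G\subseteq X$ and $\limsup_{\beta\to+\infty}\frac1\beta\log\nu_\beta(K)\le-\inf_{x\in K}I(x)$ for every closed $K\subseteq X$. *)

theory Defs
  imports "HOL-Analysis.Analysis" "HOL-Probability.Probability"
begin

section \<open>Expanding covering maps\<close>

definition distance_expanding :: "('a::metric_space \<Rightarrow> 'a) \<Rightarrow> bool" where
  "distance_expanding T \<longleftrightarrow>
     (\<exists>lam>1. \<exists>eta>0. \<forall>x y. dist x y \<le> 2 * eta \<longrightarrow> dist (T x) (T y) \<ge> lam * dist x y)"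

definition local_homeomorphism :: "('a::topological_space \<Rightarrow> 'a) \<Rightarrow> bool" where
  "local_homeomorphism T \<longleftrightarrow>
     (\<forall>x. \<exists>U. open U \<and> x \<in> U \<and> open (T ` U) \<and> (\<exists>S. homeomorphism U (T ` U) T S))"

definition covering_map :: "('a::topological_space \<Rightarrow> 'a) \<Rightarrow> bool" where
  "covering_map T \<longleftrightarrow>
     open_map euclidean euclidean T \<and> continuous_on UNIV T \<and> surj T \<and> local_homeomorphism T"

definition expanding_covering_map :: "('a::metric_space \<Rightarrow> 'a) \<Rightarrow> bool" where
  "expanding_covering_map T \<longleftrightarrow> covering_map T \<and> distance_expanding T"

text \<open>Iterates start at \<open>n = 0\<close>; for surjective continuous maps, requiring \<open>n \<ge> 1\<close>
  gives the same notion.\<close>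

definition topologically_transitive :: "('a::topological_space \<Rightarrow> 'a) \<Rightarrow> bool" where
  "topologically_transitive T \<longleftrightarrow>
     (\<forall>U V. open U \<longrightarrow> open V \<longrightarrow> U \<noteq> {} \<longrightarrow> V \<noteq> {} \<longrightarrow> (\<exists>n. (T ^^ n) ` U \<inter> V \<noteq> {}))"

definition holder_continuous :: "real \<Rightarrow> ('a::metric_space \<Rightarrow> real) \<Rightarrow> bool" where
  "holder_continuous a f \<longleftrightarrow> (\<exists>C. \<forall>x y. \<bar>f x - f y\<bar> \<le> C * dist x y powr a)"

section \<open>Measure-theoretic entropy, pressure and equilibrium states\<close>

definition borel_prob :: "'a::topological_space measure \<Rightarrow> bool" where
  "borel_prob M \<longleftrightarrow> sets M = sets borel \<and> prob_space M"

definition invariant_prob :: "('a::topological_space \<Rightarrow> 'a) \<Rightarrow> 'a measure \<Rightarrow> bool" where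
  "invariant_prob T M \<longleftrightarrow> borel_prob M \<and> distr M M T = M"

definition finite_borel_partition :: "'a::topological_space set set \<Rightarrow> bool" where
  "finite_borel_partition P \<longleftrightarrow> finite P \<and> P \<subseteq> sets borel \<and> partition_on UNIV P"

text \<open>The common refinement of \<open>P, T\<^sup>-\<^sup>1P, \<dots>, T\<^sup>-\<^sup>(\<^sup>n\<^sup>-\<^sup>1\<^sup>)P\<close>. It may contain the empty set, which
  contributes nothing to the entropy since \<open>0 * ln 0 = 0\<close>.\<close>

definition dynamical_join :: "('a \<Rightarrow> 'a) \<Rightarrow> 'a set set \<Rightarrow> nat \<Rightarrow> 'a set set" where
  "dynamical_join T P n = {\<Inter>i\<in>{..<n}. (T ^^ i) -` c i | c. c \<in> {..<n} \<rightarrow> P}"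

definition partition_entropy :: "'a measure \<Rightarrow> 'a set set \<Rightarrow> real" where
  "partition_entropy M P = - (\<Sum>C\<in>P. measure M C * ln (measure M C))"

definition entropy_wrt_partition :: "('a \<Rightarrow> 'a) \<Rightarrow> 'a measure \<Rightarrow> 'a set set \<Rightarrow> real" where
  "entropy_wrt_partition T M P = lim (\<lambda>n. partition_entropy M (dynamical_join T P n) / real n)"

definition ks_entropy :: "('a::topological_space \<Rightarrow> 'a) \<Rightarrow> 'a measure \<Rightarrow> ereal" where
  "ks_entropy T M = (SUP P\<in>{P. finite_borel_partition P}. ereal (entropy_wrt_partition T M P))"

definition free_energy ::
  "('a::topological_space \<Rightarrow> 'a) \<Rightarrow> ('a \<Rightarrow> real) \<Rightarrow> 'a measure \<Rightarrow> ereal" where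
  "free_energy T \<phi> M = ks_entropy T M + ereal (\<integral>x. \<phi> x \<partial>M)"

text \<open>For a continuous potential and an expanding covering map of a compact space the supremum
  is a finite maximum, so the conversion to a real number loses nothing.\<close>

definition pressure :: "('a::topological_space \<Rightarrow> 'a) \<Rightarrow> ('a \<Rightarrow> real) \<Rightarrow> real" where
  "pressure T \<phi> = real_of_ereal (SUP M\<in>{M. invariant_prob T M}. free_energy T \<phi> M)"

definition equilibrium_state ::
  "('a::topological_space \<Rightarrow> 'a) \<Rightarrow> ('a \<Rightarrow> real) \<Rightarrow> 'a measure \<Rightarrow> bool" where
  "equilibrium_state T \<phi> M \<longleftrightarrow> invariant_prob T M \<and>
     free_energy T \<phi> M = (SUP N\<in>{N. invariant_prob T N}. free_energy T \<phi> N)"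

section \<open>Ruelle operator\<close>

text \<open>Fibres of an expanding covering map of a compact space are finite, so this is the intended
  sum over all preimages.\<close>

definition ruelle :: "('a \<Rightarrow> 'a) \<Rightarrow> ('a \<Rightarrow> real) \<Rightarrow> ('a \<Rightarrow> real) \<Rightarrow> 'a \<Rightarrow> real" where
  "ruelle T \<phi> u x = (\<Sum>y\<in>T -` {x}. u y * exp (\<phi> y))"

text \<open>The equation \<open>R\<^sup>*m = exp P m\<close> is read as an identity of functionals on \<open>C(X,\<real>)\<close>.\<close>

definition ruelle_eigenmeasure ::
  "('a::topological_space \<Rightarrow> 'a) \<Rightarrow> ('a \<Rightarrow> real) \<Rightarrow> 'a measure \<Rightarrow> bool" where
  "ruelle_eigenmeasure T \<phi> m \<longleftrightarrow> borel_prob m \<and>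
     (\<forall>v. continuous_on UNIV v \<longrightarrow>
        (\<integral>x. ruelle T \<phi> v x \<partial>m) = exp (pressure T \<phi>) * (\<integral>x. v x \<partial>m))"

definition ruelle_eigenfunction ::
  "('a::topological_space \<Rightarrow> 'a) \<Rightarrow> ('a \<Rightarrow> real) \<Rightarrow> 'a measure \<Rightarrow> ('a \<Rightarrow> real) \<Rightarrow> bool" where
  "ruelle_eigenfunction T \<phi> m u \<longleftrightarrow>
     continuous_on UNIV u \<and> (\<forall>x. u x > 0) \<and>
     (\<forall>x. ruelle T \<phi> u x = exp (pressure T \<phi>) * u x) \<and> (\<integral>x. u x \<partial>m) = 1"

definition normalized_potential ::
  "('a::topological_space \<Rightarrow> 'a) \<Rightarrow> ('a \<Rightarrow> real) \<Rightarrow> ('a \<Rightarrow> real) \<Rightarrow> 'a \<Rightarrow> real" where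
  "normalized_potential T \<phi> u x = \<phi> x + ln (u x) - ln (u (T x)) - pressure T \<phi>"

definition log_laplace ::
  "(real \<Rightarrow> 'a::topological_space measure) \<Rightarrow> real \<Rightarrow> ('a \<Rightarrow>\<^sub>C real) \<Rightarrow> real" where
  "log_laplace m \<beta> f = (1 / \<beta>) * ln (\<integral>x. exp (\<beta> * apply_bcontfun f x) \<partial>(m \<beta>))"

section \<open>Large deviations\<close>

definition ext_ln :: "real \<Rightarrow> ereal" where
  "ext_ln p = (if p \<le> 0 then - \<infinity> else ereal (ln p))"

definition lower_semicontinuous :: "('a::topological_space \<Rightarrow> ereal) \<Rightarrow> bool" where
  "lower_semicontinuous I \<longleftrightarrow> (\<forall>c. open {x. c < I x})"

definition large_deviation_principle ::
  "(real \<Rightarrow> 'a::topological_space measure) \<Rightarrow> bool" where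
  "large_deviation_principle \<nu> \<longleftrightarrow>
     (\<exists>I. lower_semicontinuous I \<and> (\<forall>x. 0 \<le> I x) \<and>
        (\<forall>G. open G \<longrightarrow>
           Liminf at_top (\<lambda>\<beta>. ereal (1 / \<beta>) * ext_ln (measure (\<nu> \<beta>) G)) \<ge> - (INF x\<in>G. I x)) \<and>
        (\<forall>K. closed K \<longrightarrow>
           Limsup at_top (\<lambda>\<beta>. ereal (1 / \<beta>) * ext_ln (measure (\<nu> \<beta>) K)) \<le> - (INF x\<in>K. I x)))"

end

theory Submission
  imports Defs
begin

text \<open>
  Write \<open>W\<^sub>\<beta> = (1/\<beta>) ln u\<^sub>\<beta>\<close> and let \<open>G\<^sub>\<beta>\<close> be the normalized potential divided by \<open>\<beta>\<close>, so that
  \<open>G\<^sub>\<beta> = A + W\<^sub>\<beta> - W\<^sub>\<beta> \<circ> T - P(\<beta>A)/\<beta>\<close>. Inverse branches of \<open>T\<close> contract distances, so the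
  eigenvalue equation makes \<open>W\<^sub>\<beta>\<close> and hence \<open>G\<^sub>\<beta>\<close> equicontinuous, uniformly in \<open>\<beta>\<close>
  (\<open>eigenfunction_distortion\<close>, \<open>W_modulus\<close>), and transitivity bounds \<open>G\<^sub>\<beta>\<close> uniformly for
  \<open>\<beta> \<ge> 1\<close>.

  The heart of the forward direction is that the rate function \<open>I\<close> determines the limit of
  \<open>G\<^sub>\<beta>\<close>. The equation for the eigenmeasure says that \<open>exp (- \<beta> G\<^sub>\<beta>)\<close> is the Jacobian of
  \<open>\<mu>\<^sub>\<beta>\<close>: the image under \<open>T\<close> of a small ball \<open>B\<close> around \<open>x\<close> has mass about
  \<open>exp (- \<beta> G\<^sub>\<beta>(x)) \<mu>\<^sub>\<beta>(B)\<close>. On the logarithmic scale the large deviation principle turns this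
  into \<open>G\<^sub>\<beta>(x) \<rightarrow> I(T x) - I(x)\<close> whenever \<open>I(x)\<close> is finite (\<open>G_tendsto_at_finite_rate\<close>). The
  set where \<open>I\<close> is finite is nonempty and contains the preimages of its points, hence is dense,
  and equicontinuity upgrades pointwise convergence there to uniform convergence
  (\<open>G_uniform_limit\<close>).

  If \<open>G\<^sub>\<beta>\<close> and \<open>G\<^sub>\<gamma>\<close> are close then \<open>D = W\<^sub>\<beta> - W\<^sub>\<gamma>\<close> satisfies
  \<open>D - D \<circ> T \<approx> const\<close>; the extrema of \<open>D\<close> force the constant to be small, and
  transitivity then forces \<open>D\<close> to be almost constant. So \<open>W\<^sub>\<beta>\<close> converges up to additive
  constants, which are controlled by the normalization \<open>\<integral> exp (- \<beta> W\<^sub>\<beta>) d\<mu>\<^sub>\<beta> = 1\<close> and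
  Varadhan's lemma (\<open>W_uniform_limit\<close>).

  Finally \<open>m\<^sub>\<beta>\<close> and \<open>\<mu>\<^sub>\<beta>\<close> differ by the density \<open>exp (\<beta> W\<^sub>\<beta>)\<close>, so Laplace functionals of one are
  those of the other at a function shifted by \<open>W\<^sub>\<beta>\<close>. With \<open>W\<^sub>\<beta>\<close> convergent, convergence of
  one family of functionals is convergence of the other. Varadhan's lemma (\<open>varadhan\<close>) derives
  that convergence from the large deviation principle, and Bryc's inverse (\<open>bryc\<close>) derives the
  principle from it; uniformity on compact sets is automatic because the functionals are
  1-Lipschitz.
\<close>

section \<open>Laplace functionals and the large deviation principle\<close>

text \<open>The parameter selects the measure and sets the scale, as in the functionals of Varadhan and Bryc.\<close>

definition scaled_log_mgf :: "(real \<Rightarrow> 'a measure) \<Rightarrow> real \<Rightarrow> ('a \<Rightarrow> real) \<Rightarrow> real" where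
  "scaled_log_mgf \<nu> \<beta> f = (1 / \<beta>) * ln (\<integral>x. exp (\<beta> * f x) \<partial>\<nu> \<beta>)"

text \<open>The large deviation principle with real exponents in place of infima and extended logarithms:
  a point of small rate bounds the mass of its neighbourhoods from below, and a lower bound for
  the rate on a closed set bounds its mass from above. The slack between \<open>c'\<close> and \<open>c\<close> absorbs
  the limes superior.\<close>

definition exponential_bounds :: "(real \<Rightarrow> 'a::topological_space measure) \<Rightarrow> ('a \<Rightarrow> ereal) \<Rightarrow> bool" where
  "exponential_bounds \<nu> I \<longleftrightarrow> lower_semicontinuous I \<and> (\<forall>x. 0 \<le> I x) \<and>
     (\<forall>G x a. open G \<longrightarrow> x \<in> G \<longrightarrow> I x < ereal a \<longrightarrow>
        (\<forall>\<^sub>F \<beta> in at_top. exp (\<beta> * - a) \<le> measure (\<nu> \<beta>) G)) \<and>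
     (\<forall>K c c'. closed K \<longrightarrow> (\<forall>x\<in>K. ereal c \<le> I x) \<longrightarrow> c' < c \<longrightarrow>
        (\<forall>\<^sub>F \<beta> in at_top. measure (\<nu> \<beta>) K \<le> exp (\<beta> * - c')))"

lemma exponential_boundsD:
  assumes "exponential_bounds \<nu> I"
  shows "lower_semicontinuous I" "0 \<le> I x"
    and "open G \<Longrightarrow> x \<in> G \<Longrightarrow> I x < ereal a \<Longrightarrow>
      \<forall>\<^sub>F \<beta> in at_top. exp (\<beta> * - a) \<le> measure (\<nu> \<beta>) G"
    and "closed K \<Longrightarrow> (\<And>x. x \<in> K \<Longrightarrow> ereal c \<le> I x) \<Longrightarrow> c' < c \<Longrightarrow>
      \<forall>\<^sub>F \<beta> in at_top. measure (\<nu> \<beta>) K \<le> exp (\<beta> * - c')"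
proof -
  note * = assms[unfolded exponential_bounds_def]
  show "lower_semicontinuous I" "0 \<le> I x" using * by simp_all
  show "open G \<Longrightarrow> x \<in> G \<Longrightarrow> I x < ereal a \<Longrightarrow>
      \<forall>\<^sub>F \<beta> in at_top. exp (\<beta> * - a) \<le> measure (\<nu> \<beta>) G"
    using conjunct1[OF conjunct2[OF conjunct2[OF *]]] by metis
  show "closed K \<Longrightarrow> (\<And>x. x \<in> K \<Longrightarrow> ereal c \<le> I x) \<Longrightarrow> c' < c \<Longrightarrow>
      \<forall>\<^sub>F \<beta> in at_top. measure (\<nu> \<beta>) K \<le> exp (\<beta> * - c')"
    using conjunct2[OF conjunct2[OF conjunct2[OF *]]] by metis
qed

lemma scaled_ext_ln_ge_iff:
  assumes "\<beta> > 0"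
  shows "ereal a \<le> ereal (1 / \<beta>) * ext_ln p \<longleftrightarrow> exp (\<beta> * a) \<le> p"
proof (cases "p \<le> 0")
  case True
  moreover have "\<not> exp (\<beta> * a) \<le> p" using True by (metis exp_gt_zero not_le order.trans)
  ultimately show ?thesis using assms by (simp add: ext_ln_def)
next
  case False
  then have "exp (\<beta> * a) \<le> p \<longleftrightarrow> \<beta> * a \<le> ln p" by (simp add: ln_ge_iff)
  then show ?thesis using assms False by (simp add: ext_ln_def field_simps)
qed

lemma scaled_ext_ln_le_iff:
  assumes "\<beta> > 0"
  shows "ereal (1 / \<beta>) * ext_ln p \<le> ereal a \<longleftrightarrow> p \<le> exp (\<beta> * a)"
proof (cases "p \<le> 0")
  case True
  moreover have "p \<le> exp (\<beta> * a)" using True by (meson exp_ge_zero order_trans)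
  ultimately show ?thesis using assms by (simp add: ext_ln_def)
next
  case False
  then have "p \<le> exp (\<beta> * a) \<longleftrightarrow> ln p \<le> \<beta> * a"
    by (metis exp_le_cancel_iff exp_ln linorder_not_le)
  then show ?thesis using assms False by (simp add: ext_ln_def field_simps)
qed

lemma exponential_bounds_if_ldp:
  assumes "large_deviation_principle \<nu>"
  obtains I where "exponential_bounds \<nu> I"
proof -
  obtain I where I: "lower_semicontinuous I" "\<And>x. 0 \<le> I x"
    and lo: "\<And>G. open G \<Longrightarrow>
        Liminf at_top (\<lambda>\<beta>. ereal (1 / \<beta>) * ext_ln (measure (\<nu> \<beta>) G)) \<ge> - (INF x\<in>G. I x)"
    and up: "\<And>K. closed K \<Longrightarrow>
        Limsup at_top (\<lambda>\<beta>. ereal (1 / \<beta>) * ext_ln (measure (\<nu> \<beta>) K)) \<le> - (INF x\<in>K. I x)"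
    using assms unfolding large_deviation_principle_def by blast
  have pos: "\<forall>\<^sub>F \<beta>::real in at_top. 0 < \<beta>" by (rule eventually_gt_at_top)
  have "exponential_bounds \<nu> I" unfolding exponential_bounds_def
  proof (intro conjI allI impI)
    fix G x a assume "open G" "x \<in> G" "I x < ereal a"
    then have "ereal (- a) < - (INF x\<in>G. I x)"
      by (metis INF_lower ereal_minus_less_minus le_less_trans uminus_ereal.simps(1))
    then have "ereal (- a) < Liminf at_top (\<lambda>\<beta>. ereal (1 / \<beta>) * ext_ln (measure (\<nu> \<beta>) G))"
      using lo[OF \<open>open G\<close>] by (rule less_le_trans)
    then have "\<forall>\<^sub>F \<beta> in at_top. ereal (- a) < ereal (1 / \<beta>) * ext_ln (measure (\<nu> \<beta>) G)"
      by (rule less_LiminfD)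
    with pos show "\<forall>\<^sub>F \<beta> in at_top. exp (\<beta> * - a) \<le> measure (\<nu> \<beta>) G"
    proof eventually_elim
      case (elim \<beta>)
      then show ?case using scaled_ext_ln_ge_iff[of \<beta> "- a" "measure (\<nu> \<beta>) G"] less_imp_le by blast
    qed
  next
    fix K and c c' :: real assume "closed K" "\<forall>x\<in>K. ereal c \<le> I x" "c' < c"
    then have "ereal c \<le> (INF x\<in>K. I x)" by (simp add: INF_greatest)
    then have "ereal c' < (INF x\<in>K. I x)" using \<open>c' < c\<close> by (meson ereal_less_le less_ereal.simps(1) less_le_trans)
    then have "- (INF x\<in>K. I x) < ereal (- c')"
      by (metis ereal_minus_less_minus uminus_ereal.simps(1))
    then have "Limsup at_top (\<lambda>\<beta>. ereal (1 / \<beta>) * ext_ln (measure (\<nu> \<beta>) K)) < ereal (- c')"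
      using up[OF \<open>closed K\<close>] by (rule le_less_trans[rotated])
    then have "\<forall>\<^sub>F \<beta> in at_top. ereal (1 / \<beta>) * ext_ln (measure (\<nu> \<beta>) K) < ereal (- c')"
      by (rule Limsup_lessD)
    with pos show "\<forall>\<^sub>F \<beta> in at_top. measure (\<nu> \<beta>) K \<le> exp (\<beta> * - c')"
    proof eventually_elim
      case (elim \<beta>)
      then show ?case using scaled_ext_ln_le_iff[of \<beta> "measure (\<nu> \<beta>) K" "- c'"] less_imp_le by blast
    qed
  qed (use I in auto)
  then show thesis by (rule that)
qed

lemma ldp_if_exponential_bounds:
  assumes I: "exponential_bounds \<nu> I"
  shows "large_deviation_principle \<nu>"
  unfolding large_deviation_principle_def
proof (intro exI[of _ I] conjI allI impI)
  have pos: "\<forall>\<^sub>F \<beta>::real in at_top. 0 < \<beta>" by (rule eventually_gt_at_top)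
  show "lower_semicontinuous I" "\<And>x. 0 \<le> I x" using exponential_boundsD[OF I] by auto
  fix G :: "'a set" assume "open G"
  show "- (INF x\<in>G. I x) \<le> Liminf at_top (\<lambda>\<beta>. ereal (1 / \<beta>) * ext_ln (measure (\<nu> \<beta>) G))"
    unfolding le_Liminf_iff
  proof (intro allI impI)
    fix y assume "y < - (INF x\<in>G. I x)"
    then have "(INF x\<in>G. I x) < - y" using ereal_less_uminus_reorder by blast
    then obtain x where x: "x \<in> G" "I x < - y" unfolding INF_less_iff by blast
    obtain a where a: "I x < ereal a" "ereal a < - y" using ereal_dense2[OF x(2)] by blast
    then have ya: "y < ereal (- a)" using ereal_less_uminus_reorder[of y "ereal a"] by simp
    from pos exponential_boundsD(3)[OF I \<open>open G\<close> x(1) a(1)]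
    show "\<forall>\<^sub>F \<beta> in at_top. y < ereal (1 / \<beta>) * ext_ln (measure (\<nu> \<beta>) G)"
    proof eventually_elim
      case (elim \<beta>)
      then show ?case using scaled_ext_ln_ge_iff[of \<beta> "- a" "measure (\<nu> \<beta>) G"] ya
        by (meson less_le_trans)
    qed
  qed
next
  have pos: "\<forall>\<^sub>F \<beta>::real in at_top. 0 < \<beta>" by (rule eventually_gt_at_top)
  fix K :: "'a set" assume "closed K"
  show "Limsup at_top (\<lambda>\<beta>. ereal (1 / \<beta>) * ext_ln (measure (\<nu> \<beta>) K)) \<le> - (INF x\<in>K. I x)"
    unfolding Limsup_le_iff
  proof (intro allI impI)
    fix y assume "- (INF x\<in>K. I x) < y"
    then have "- y < (INF x\<in>K. I x)" using ereal_uminus_less_reorder by blast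
    then obtain c where c: "- y < ereal c" "ereal c < (INF x\<in>K. I x)" using ereal_dense2 by blast
    obtain c' where c': "- y < ereal c'" "ereal c' < ereal c" using ereal_dense2[OF c(1)] by blast
    have yc: "ereal (- c') < y" using c'(1) ereal_uminus_less_reorder[of y "ereal c'"] by simp
    have "ereal c \<le> I x" if "x \<in> K" for x
      using c(2) INF_lower[OF that, of I] by (meson less_imp_le less_le_trans)
    then have "\<forall>\<^sub>F \<beta> in at_top. measure (\<nu> \<beta>) K \<le> exp (\<beta> * - c')"
      using c'(2) by (intro exponential_boundsD(4)[OF I \<open>closed K\<close>]) auto
    with pos show "\<forall>\<^sub>F \<beta> in at_top. ereal (1 / \<beta>) * ext_ln (measure (\<nu> \<beta>) K) < y"
    proof eventually_elim
      case (elim \<beta>)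
      then show ?case using scaled_ext_ln_le_iff[of \<beta> "measure (\<nu> \<beta>) K" "- c'"] yc
        by (simp add: le_less_trans)
    qed
  qed
qed

locale compact_prob_family =
  fixes \<nu> :: "real \<Rightarrow> 'a::metric_space measure"
  assumes compact_space: "compact (UNIV :: 'a set)"
    and borel_prob: "\<beta> > 0 \<Longrightarrow> borel_prob (\<nu> \<beta>)"
begin

lemma sets_eq: "\<beta> > 0 \<Longrightarrow> sets (\<nu> \<beta>) = sets borel"
  and is_prob: "\<beta> > 0 \<Longrightarrow> prob_space (\<nu> \<beta>)"
  using borel_prob by (auto simp: borel_prob_def)

lemma space_eq: "\<beta> > 0 \<Longrightarrow> space (\<nu> \<beta>) = UNIV"
  using sets_eq_imp_space_eq[OF sets_eq] by auto

lemma continuous_bounded: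
  fixes f :: "'a \<Rightarrow> real"
  assumes "continuous_on UNIV f"
  obtains B where "B > 0" "\<And>x. \<bar>f x\<bar> \<le> B"
proof -
  have "bounded (f ` UNIV)"
    using compact_space assms compact_continuous_image compact_imp_bounded by blast
  then obtain B where "B > 0" "\<forall>y\<in>range f. norm y \<le> B" using bounded_pos by blast
  then show thesis using that by auto
qed

lemma integrable_continuous:
  fixes f :: "'a \<Rightarrow> real"
  assumes "\<beta> > 0" "continuous_on UNIV f"
  shows "integrable (\<nu> \<beta>) f"
proof -
  interpret prob_space "\<nu> \<beta>" using is_prob assms by auto
  obtain B where "\<And>x. \<bar>f x\<bar> \<le> B" using continuous_bounded[OF assms(2)] by blast
  moreover have "f \<in> borel_measurable (\<nu> \<beta>)"
    using borel_measurable_continuous_onI[OF assms(2)]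
    by (simp add: measurable_cong_sets[OF sets_eq[OF assms(1)] refl])
  ultimately show ?thesis by (intro integrable_const_bound[of _ B]) auto
qed

lemma integrable_exp:
  assumes "\<beta> > 0" "continuous_on UNIV f"
  shows "integrable (\<nu> \<beta>) (\<lambda>x. exp (\<beta> * f x))"
  using assms by (intro integrable_continuous continuous_intros)

lemma integral_exp_mono:
  assumes "\<beta> > 0" "continuous_on UNIV f" "continuous_on UNIV h" "\<And>x. f x \<le> h x + c"
  shows "(\<integral>x. exp (\<beta> * f x) \<partial>\<nu> \<beta>) \<le> exp (\<beta> * c) * (\<integral>x. exp (\<beta> * h x) \<partial>\<nu> \<beta>)"
proof -
  have "(\<integral>x. exp (\<beta> * f x) \<partial>\<nu> \<beta>) \<le> (\<integral>x. exp (\<beta> * c) * exp (\<beta> * h x) \<partial>\<nu> \<beta>)"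
  proof (intro integral_mono integrable_mult_right integrable_exp assms(1-3))
    fix x
    have "\<beta> * f x \<le> \<beta> * c + \<beta> * h x"
      using assms(1) assms(4)[of x] by (metis add.commute distrib_left mult_left_mono less_imp_le)
    then show "exp (\<beta> * f x) \<le> exp (\<beta> * c) * exp (\<beta> * h x)" by (simp flip: exp_add)
  qed
  then show ?thesis by simp
qed

lemma integral_exp_pos:
  assumes "\<beta> > 0" "continuous_on UNIV f"
  shows "0 < (\<integral>x. exp (\<beta> * f x) \<partial>\<nu> \<beta>)"
proof -
  interpret prob_space "\<nu> \<beta>" using is_prob assms by auto
  obtain B where B: "\<And>x. \<bar>f x\<bar> \<le> B" using continuous_bounded[OF assms(2)] by blast
  have "0 \<le> f x + B" for x using B[of x] by linarith
  then have "(\<integral>x. exp (\<beta> * 0) \<partial>\<nu> \<beta>) \<le> exp (\<beta> * B) * (\<integral>x. exp (\<beta> * f x) \<partial>\<nu> \<beta>)"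
    by (intro integral_exp_mono assms continuous_intros)
  then have "0 < exp (\<beta> * B) * (\<integral>x. exp (\<beta> * f x) \<partial>\<nu> \<beta>)" by (simp add: prob_space)
  then show ?thesis by (simp add: zero_less_mult_iff)
qed

lemma scaled_log_mgf_mono:
  assumes "\<beta> > 0" "continuous_on UNIV f" "continuous_on UNIV h" "\<And>x. f x \<le> h x + c"
  shows "scaled_log_mgf \<nu> \<beta> f \<le> scaled_log_mgf \<nu> \<beta> h + c"
proof -
  have "ln (\<integral>x. exp (\<beta> * f x) \<partial>\<nu> \<beta>) \<le> ln (exp (\<beta> * c) * (\<integral>x. exp (\<beta> * h x) \<partial>\<nu> \<beta>))"
    using integral_exp_mono[OF assms] integral_exp_pos assms by (intro ln_mono) auto
  also have "\<dots> = \<beta> * c + ln (\<integral>x. exp (\<beta> * h x) \<partial>\<nu> \<beta>)"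
    using integral_exp_pos[OF assms(1,3)] by (subst ln_mult_pos) auto
  finally show ?thesis using assms(1) by (simp add: scaled_log_mgf_def field_simps)
qed

lemma scaled_log_mgf_lipschitz:
  assumes "\<beta> > 0" "continuous_on UNIV f" "continuous_on UNIV h" "\<And>x. \<bar>f x - h x\<bar> \<le> c"
  shows "\<bar>scaled_log_mgf \<nu> \<beta> f - scaled_log_mgf \<nu> \<beta> h\<bar> \<le> c"
proof -
  have "f x \<le> h x + c" "h x \<le> f x + c" for x using assms(4)[of x] by linarith+
  then show ?thesis
    using scaled_log_mgf_mono[of \<beta> f h c] scaled_log_mgf_mono[of \<beta> h f c] assms by force
qed

lemma scaled_log_mgf_uniform_limit:
  assumes lim: "((\<lambda>\<beta>. scaled_log_mgf \<nu> \<beta> f) \<longlongrightarrow> L) at_top"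
    and cont: "\<And>\<beta>. \<beta> > 0 \<Longrightarrow> continuous_on UNIV (F \<beta>)" "continuous_on UNIV f"
    and unif: "uniform_limit UNIV F f at_top"
  shows "((\<lambda>\<beta>. scaled_log_mgf \<nu> \<beta> (F \<beta>)) \<longlongrightarrow> L) at_top"
proof -
  have "((\<lambda>\<beta>. scaled_log_mgf \<nu> \<beta> (F \<beta>) - scaled_log_mgf \<nu> \<beta> f) \<longlongrightarrow> 0) at_top"
  proof (rule tendstoI)
    fix e :: real assume "e > 0"
    then have "e / 2 > 0" by simp
    with unif have "\<forall>\<^sub>F \<beta> in at_top. \<forall>x\<in>UNIV. dist (F \<beta> x) (f x) < e / 2" by (rule uniform_limitD)
    with eventually_gt_at_top[of 0]
    show "\<forall>\<^sub>F \<beta> in at_top. dist (scaled_log_mgf \<nu> \<beta> (F \<beta>) - scaled_log_mgf \<nu> \<beta> f) 0 < e"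
    proof eventually_elim
      case (elim \<beta>)
      then have "\<bar>scaled_log_mgf \<nu> \<beta> (F \<beta>) - scaled_log_mgf \<nu> \<beta> f\<bar> \<le> e / 2"
        by (intro scaled_log_mgf_lipschitz cont) (auto simp: dist_real_def intro: less_imp_le)
      then show ?case using \<open>e > 0\<close> by (simp add: dist_real_def)
    qed
  qed
  from tendsto_add[OF this lim] show ?thesis by simp
qed

lemma integral_exp_eq:
  assumes "\<beta> > 0" "continuous_on UNIV f"
  shows "(\<integral>x. exp (\<beta> * f x) \<partial>\<nu> \<beta>) = exp (\<beta> * scaled_log_mgf \<nu> \<beta> f)"
  using assms integral_exp_pos by (simp add: scaled_log_mgf_def)

lemma exp_measure_le_integral:
  assumes "\<beta> > 0" "continuous_on UNIV f" "S \<in> sets borel" "\<And>x. x \<in> S \<Longrightarrow> c \<le> f x"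
  shows "exp (\<beta> * c) * measure (\<nu> \<beta>) S \<le> (\<integral>x. exp (\<beta> * f x) \<partial>\<nu> \<beta>)"
proof -
  interpret prob_space "\<nu> \<beta>" using is_prob assms by auto
  have S: "S \<in> sets (\<nu> \<beta>)" using assms sets_eq by auto
  have "(\<integral>x. exp (\<beta> * c) * indicator S x \<partial>\<nu> \<beta>) \<le> (\<integral>x. exp (\<beta> * f x) \<partial>\<nu> \<beta>)"
    using S assms(1,4) integrable_exp[OF assms(1,2)]
    by (intro integral_mono integrable_mult_right integrable_real_indicator)
       (auto simp: indicator_def emeasure_eq_measure)
  then show ?thesis using S by (simp add: space_eq[OF assms(1)])
qed

end

lemma scaled_ln_tendstoI:
  fixes F :: "real \<Rightarrow> real"
  assumes "\<And>e. e > 0 \<Longrightarrow> \<forall>\<^sub>F \<beta> in at_top. exp (\<beta> * (L - e)) \<le> F \<beta> \<and> F \<beta> \<le> exp (\<beta> * (L + e))"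
  shows "((\<lambda>\<beta>. (1 / \<beta>) * ln (F \<beta>)) \<longlongrightarrow> L) at_top"
proof (rule tendstoI)
  fix e :: real assume "e > 0"
  then have "e / 2 > 0" by simp
  from assms[OF this] eventually_gt_at_top[of 0]
  show "\<forall>\<^sub>F \<beta> in at_top. dist (1 / \<beta> * ln (F \<beta>)) L < e"
  proof eventually_elim
    case (elim \<beta>)
    have pos: "F \<beta> > 0" using elim by (meson exp_gt_zero less_le_trans)
    have "\<beta> * (L - e / 2) \<le> ln (F \<beta>)" using elim pos by (simp add: ln_ge_iff)
    moreover have "ln (F \<beta>) \<le> \<beta> * (L + e / 2)"
      using elim pos by (metis exp_le_cancel_iff exp_ln)
    ultimately have "L - e / 2 \<le> 1 / \<beta> * ln (F \<beta>)" "1 / \<beta> * ln (F \<beta>) \<le> L + e / 2"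
      using elim by (auto simp: field_simps)
    then show ?case using \<open>e > 0\<close> unfolding dist_real_def by linarith
  qed
qed

context compact_prob_family
begin

text \<open>An identically infinite rate would make the total mass, which is \<open>1\<close>, decay exponentially.\<close>

lemma rate_function_finite_somewhere:
  assumes I: "exponential_bounds \<nu> I"
  obtains x a where "I x < ereal a"
proof -
  have "\<exists>x. I x < ereal 1"
  proof (rule ccontr)
    assume "\<not> ?thesis"
    then have "\<forall>\<^sub>F \<beta> in at_top. measure (\<nu> \<beta>) UNIV \<le> exp (\<beta> * - (1 / 2))"
      by (intro exponential_boundsD(4)[OF I, of _ 1]) (auto simp: not_less)
    with eventually_gt_at_top[of 0] have "\<forall>\<^sub>F \<beta>::real in at_top. False"
    proof eventually_elim
      case (elim \<beta>)
      then have "measure (\<nu> \<beta>) UNIV = 1"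
        using prob_space.prob_space[OF is_prob] space_eq by fastforce
      then show ?case using elim by simp
    qed
    then show False by simp
  qed
  then show thesis using that by blast
qed

text \<open>The range of \<open>f\<close> is cut into finitely many slabs of height \<open>e\<close>. On each of them \<open>exp (\<beta> f)\<close>
  is constant up to a factor \<open>exp (\<beta> e)\<close>, so that the integral is controlled by the masses of
  closed sets.\<close>

lemma integral_exp_le_grid_sum:
  fixes J :: nat
  assumes "\<beta> > 0" "continuous_on UNIV f" "e > 0"
    and B: "\<And>x. \<bar>f x\<bar> \<le> B" and J: "2 * B \<le> real J * e"
  defines "t \<equiv> \<lambda>j::nat. - B + real j * e"
  shows "(\<integral>x. exp (\<beta> * f x) \<partial>\<nu> \<beta>)
    \<le> (\<Sum>j\<le>J. exp (\<beta> * (t j + e)) * measure (\<nu> \<beta>) {x. t j \<le> f x \<and> f x \<le> t j + e})"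
proof -
  interpret prob_space "\<nu> \<beta>" using is_prob assms by auto
  define K where "K j = {x. t j \<le> f x \<and> f x \<le> t j + e}" for j
  have "closed (K j)" for j
    unfolding K_def by (intro closed_Collect_conj closed_Collect_le continuous_intros assms)
  then have K: "K j \<in> sets (\<nu> \<beta>)" for j using sets_eq[OF assms(1)] by auto
  have nn: "0 \<le> exp (\<beta> * (t i + e)) * indicat_real (K i) x" for i x by simp
  have pt: "exp (\<beta> * f x) \<le> (\<Sum>j\<le>J. exp (\<beta> * (t j + e)) * indicator (K j) x)" for x
  proof -
    define j where "j = nat \<lfloor>(f x + B) / e\<rfloor>"
    have ge: "0 \<le> (f x + B) / e" using B[of x] assms(3) by (simp add: abs_le_iff)
    have rj: "real j = of_int \<lfloor>(f x + B) / e\<rfloor>" using ge by (simp add: j_def)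
    have l: "real j \<le> (f x + B) / e" "(f x + B) / e < real j + 1" unfolding rj by linarith+
    then have xK: "x \<in> K j" using assms(3) by (auto simp: K_def t_def field_simps)
    have "(f x + B) / e \<le> real J" using J B[of x] assms(3) by (simp add: field_simps abs_le_iff)
    then have "j \<le> J" using l by linarith
    have "exp (\<beta> * f x) \<le> exp (\<beta> * (t j + e)) * indicator (K j) x"
      using xK assms(1) by (simp add: K_def)
    also have "\<dots> \<le> (\<Sum>j\<le>J. exp (\<beta> * (t j + e)) * indicator (K j) x)"
      using \<open>j \<le> J\<close> by (intro member_le_sum) auto
    finally show ?thesis .
  qed
  have int: "integrable (\<nu> \<beta>) (\<lambda>x. exp (\<beta> * (t j + e)) * indicator (K j) x)" for j
    using K by (intro integrable_mult_right integrable_real_indicator) (auto simp: emeasure_eq_measure)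
  have "(\<integral>x. exp (\<beta> * f x) \<partial>\<nu> \<beta>) \<le> (\<integral>x. (\<Sum>j\<le>J. exp (\<beta> * (t j + e)) * indicator (K j) x) \<partial>\<nu> \<beta>)"
    using int pt by (intro integral_mono integrable_exp Bochner_Integration.integrable_sum assms(1,2)) auto
  also have "\<dots> = (\<Sum>j\<le>J. exp (\<beta> * (t j + e)) * measure (\<nu> \<beta>) (K j))"
    using int K by (subst Bochner_Integration.integral_sum) (auto simp: space_eq[OF assms(1)])
  finally show ?thesis unfolding K_def .
qed

text \<open>The limit is the supremum \<open>L\<close> of \<open>f - I\<close>. A near-maximizer has a neighbourhood which alone
  contributes almost \<open>exp (\<beta> L)\<close>; conversely \<open>I \<ge> f - L\<close> makes each slab of the grid contribute
  at most about \<open>exp (\<beta> L)\<close>, and the number of slabs does not grow with \<open>\<beta>\<close>.\<close>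

lemma varadhan:
  assumes I: "exponential_bounds \<nu> I" and f: "continuous_on UNIV f"
  shows "\<exists>L. ((\<lambda>\<beta>. scaled_log_mgf \<nu> \<beta> f) \<longlongrightarrow> L) at_top"
proof -
  obtain B where "B > 0" and B: "\<And>x. \<bar>f x\<bar> \<le> B" using continuous_bounded[OF f] by blast
  \<comment> \<open>Real numbers \<open>a\<close> above the rate replace the possibly infinite rate itself.\<close>
  define S where "S = {f x - a |x a. I x < ereal a}"
  define L where "L = Sup S"
  have bdd: "bdd_above S"
  proof (rule bdd_aboveI)
    fix s assume "s \<in> S"
    then obtain x a where s: "s = f x - a" "I x < ereal a" by (auto simp: S_def)
    then have "0 < ereal a" using exponential_boundsD(2)[OF I, of x] by (meson le_less_trans)
    then show "s \<le> B" using s B[of x] by (simp add: abs_le_iff)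
  qed
  have "S \<noteq> {}" by (rule rate_function_finite_somewhere[OF I]) (auto simp: S_def)
  have I_ge: "ereal (f x - L) \<le> I x" for x
  proof (rule ccontr)
    assume "\<not> ?thesis"
    then have "I x < ereal (f x - L)" by (simp add: not_le)
    then obtain a where a: "I x < ereal a" "ereal a < ereal (f x - L)"
      using ereal_dense2 by blast
    then have "f x - a \<le> L" unfolding L_def by (intro cSup_upper bdd) (auto simp: S_def)
    then show False using a by simp
  qed
  have "((\<lambda>\<beta>. (1 / \<beta>) * ln (\<integral>x. exp (\<beta> * f x) \<partial>\<nu> \<beta>)) \<longlongrightarrow> L) at_top"
  proof (rule scaled_ln_tendstoI)
    fix e :: real assume "e > 0"
    obtain s where "s \<in> S" "L - e / 2 < s"
      using \<open>e > 0\<close> \<open>S \<noteq> {}\<close> bdd unfolding L_def by (metis diff_less_eq less_add_same_cancel1 half_gt_zero less_cSup_iff)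
    then obtain x a where x: "I x < ereal a" "L - e / 2 < f x - a" by (auto simp: S_def)
    define G where "G = {y. f x - e / 2 < f y}"
    have "open G" unfolding G_def by (intro open_Collect_less continuous_intros f)
    moreover have "x \<in> G" using \<open>e > 0\<close> by (simp add: G_def)
    ultimately have "\<forall>\<^sub>F \<beta> in at_top. exp (\<beta> * - a) \<le> measure (\<nu> \<beta>) G"
      using x by (intro exponential_boundsD(3)[OF I])
    with eventually_gt_at_top[of 0]
    have lower: "\<forall>\<^sub>F \<beta> in at_top. exp (\<beta> * (L - e)) \<le> (\<integral>x. exp (\<beta> * f x) \<partial>\<nu> \<beta>)"
    proof eventually_elim
      case (elim \<beta>)
      have "exp (\<beta> * (L - e)) \<le> exp (\<beta> * (f x - e / 2) + \<beta> * - a)"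
        unfolding exp_le_cancel_iff distrib_left[symmetric]
        using elim(1) x(2) by (intro mult_left_mono) auto
      also have "\<dots> \<le> exp (\<beta> * (f x - e / 2)) * measure (\<nu> \<beta>) G"
        unfolding exp_add using elim(2) by simp
      also have "\<dots> \<le> (\<integral>x. exp (\<beta> * f x) \<partial>\<nu> \<beta>)"
        using \<open>open G\<close> by (intro exp_measure_le_integral f elim(1)) (auto simp: G_def)
      finally show ?case .
    qed
    \<comment> \<open>The budget \<open>e\<close> pays for the height of a slab, for the slack in the upper bound on its mass,
      and for the number of slabs; each costs \<open>d\<close>.\<close>
    define d where "d = e / 4"
    have "d > 0" using \<open>e > 0\<close> by (simp add: d_def)
    obtain J :: nat where J: "2 * B \<le> real J * d"
      using \<open>d > 0\<close> by (metis less_imp_le reals_Archimedean3)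
    define t where "t j = - B + real j * d" for j :: nat
    have "\<forall>\<^sub>F \<beta> in at_top. \<forall>j\<in>{..J}.
        measure (\<nu> \<beta>) {x. t j \<le> f x \<and> f x \<le> t j + d} \<le> exp (\<beta> * - (t j - L - d))"
    proof (intro eventually_ball_finite ballI exponential_boundsD(4)[OF I])
      fix j :: nat
      show "closed {x. t j \<le> f x \<and> f x \<le> t j + d}"
        by (intro closed_Collect_conj closed_Collect_le continuous_intros f)
      show "ereal (t j - L) \<le> I x" if "x \<in> {x. t j \<le> f x \<and> f x \<le> t j + d}" for x
        using that I_ge[of x] by (metis (mono_tags, lifting) diff_right_mono dual_order.trans ereal_less_eq(3) mem_Collect_eq)
      show "t j - L - d < t j - L" using \<open>d > 0\<close> by simp
    qed auto
    moreover have "\<forall>\<^sub>F \<beta> in at_top. real (Suc J) \<le> exp (\<beta> * d)"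
      using \<open>d > 0\<close> by real_asymp
    ultimately have upper: "\<forall>\<^sub>F \<beta> in at_top. (\<integral>x. exp (\<beta> * f x) \<partial>\<nu> \<beta>) \<le> exp (\<beta> * (L + e))"
      using eventually_gt_at_top[of 0]
    proof eventually_elim
      case (elim \<beta>)
      have "(\<integral>x. exp (\<beta> * f x) \<partial>\<nu> \<beta>)
          \<le> (\<Sum>j\<le>J. exp (\<beta> * (t j + d)) * measure (\<nu> \<beta>) {x. t j \<le> f x \<and> f x \<le> t j + d})"
        unfolding t_def using elim J B \<open>d > 0\<close> by (intro integral_exp_le_grid_sum f)
      also have "\<dots> \<le> (\<Sum>j\<le>J. exp (\<beta> * (t j + d)) * exp (\<beta> * - (t j - L - d)))"
        using elim by (intro sum_mono mult_left_mono) auto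
      also have "\<dots> = real (Suc J) * exp (\<beta> * (L + 2 * d))"
        by (simp add: mult_exp_exp algebra_simps)
      also have "\<dots> \<le> exp (\<beta> * d) * exp (\<beta> * (L + 2 * d))"
        using elim by (intro mult_right_mono) auto
      also have "\<dots> \<le> exp (\<beta> * (L + e))"
        using elim \<open>e > 0\<close>
        unfolding mult_exp_exp exp_le_cancel_iff distrib_left[symmetric]
        by (intro mult_left_mono) (auto simp: d_def)
      finally show ?case .
    qed
    from lower upper
    show "\<forall>\<^sub>F \<beta> in at_top. exp (\<beta> * (L - e)) \<le> (\<integral>x. exp (\<beta> * f x) \<partial>\<nu> \<beta>) \<and>
        (\<integral>x. exp (\<beta> * f x) \<partial>\<nu> \<beta>) \<le> exp (\<beta> * (L + e))"
      by eventually_elim simp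
  qed
  then show ?thesis unfolding scaled_log_mgf_def by blast
qed

text \<open>The rate function is the Legendre transform of the limit functional \<open>\<Lambda>\<close>. The upper bound is
  Chebyshev's inequality for finitely many functions, by compactness; the lower bound at \<open>x\<close> tests
  \<open>\<Lambda>\<close> on a function that vanishes at \<open>x\<close> and is very negative outside the given open set.\<close>

lemma bryc:
  assumes conv: "\<And>f. continuous_on UNIV f \<Longrightarrow>
    \<exists>L. ((\<lambda>\<beta>. scaled_log_mgf \<nu> \<beta> f) \<longlongrightarrow> L) at_top"
  shows "large_deviation_principle \<nu>"
proof -
  obtain \<Lambda> where lim: "\<And>f. continuous_on UNIV f \<Longrightarrow>
      ((\<lambda>\<beta>. scaled_log_mgf \<nu> \<beta> f) \<longlongrightarrow> \<Lambda> f) at_top"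
    using conv by metis
  define I where "I x = (SUP f\<in>{f. continuous_on UNIV f}. ereal (f x - \<Lambda> f))" for x
  have I_ge: "ereal (f x - \<Lambda> f) \<le> I x" if "continuous_on UNIV f" for f x
    unfolding I_def using that by (intro SUP_upper) simp
  have "exponential_bounds \<nu> I" unfolding exponential_bounds_def
  proof (intro conjI allI impI)
    show "lower_semicontinuous I" unfolding lower_semicontinuous_def
    proof
      fix c
      have "{x. c < I x} = (\<Union>f\<in>{f. continuous_on UNIV f}. {x. c < ereal (f x - \<Lambda> f)})"
        unfolding I_def less_SUP_iff by auto
      moreover have "open {x. c < ereal (f x - \<Lambda> f)}" if "continuous_on UNIV f" for f
        using that by (intro open_Collect_less continuous_intros continuous_on_ereal)
      ultimately show "open {x. c < I x}" by auto
    qed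
  next
    fix x
    have "\<forall>\<^sub>F \<beta> in at_top. scaled_log_mgf \<nu> \<beta> (\<lambda>_. 0) = 0"
      using eventually_gt_at_top[of 0]
    proof eventually_elim
      case (elim \<beta>)
      then interpret prob_space "\<nu> \<beta>" by (rule is_prob)
      show ?case by (simp add: scaled_log_mgf_def prob_space)
    qed
    then have "((\<lambda>\<beta>. scaled_log_mgf \<nu> \<beta> (\<lambda>_. 0)) \<longlongrightarrow> 0) at_top" by (rule tendsto_eventually)
    then have "\<Lambda> (\<lambda>_. 0) = 0"
      using lim[of "\<lambda>_. 0"] by (intro tendsto_unique[OF trivial_limit_at_top_linorder]) auto
    then show "0 \<le> I x" using I_ge[of "\<lambda>_. 0" x] by (simp add: zero_ereal_def)
  next
    fix G x a assume "open G" "x \<in> G" "I x < ereal a"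
    obtain b where b: "I x < ereal b" "b < a" using ereal_dense2[OF \<open>I x < ereal a\<close>] by auto
    obtain r where r: "r > 0" "ball x r \<subseteq> G" using \<open>open G\<close> \<open>x \<in> G\<close> openE by blast
    \<comment> \<open>A cone with apex at \<open>x\<close> that has dropped below \<open>- a\<close> outside \<open>G\<close>, so that the
      integral over the complement is negligible compared with \<open>exp (- \<beta> b)\<close>.\<close>
    define M where "M = \<bar>a\<bar> + 1"
    define f where "f y = - (M / r) * dist x y" for y
    have f: "continuous_on UNIV f" unfolding f_def by (intro continuous_intros)
    have "ereal (f x - \<Lambda> f) < ereal b" using I_ge[OF f, of x] b(1) by (rule le_less_trans)
    then have "- b < \<Lambda> f" by (simp add: f_def)
    then have "\<forall>\<^sub>F \<beta> in at_top. - b < scaled_log_mgf \<nu> \<beta> f" by (rule order_tendstoD[OF lim[OF f]])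
    moreover have "\<forall>\<^sub>F \<beta> in at_top. 2 \<le> exp (\<beta> * (a - b))" using b(2) by real_asymp
    then have "\<forall>\<^sub>F \<beta> in at_top. exp (\<beta> * - a) + exp (\<beta> * - M) \<le> exp (\<beta> * - b)"
      using eventually_gt_at_top[of 0]
    proof eventually_elim
      case (elim \<beta>)
      have "exp (\<beta> * - M) \<le> exp (\<beta> * - a)" 
        unfolding exp_le_cancel_iff using elim by (intro mult_left_mono) (auto simp: M_def)
      then have "exp (\<beta> * - a) + exp (\<beta> * - M) \<le> 2 * exp (\<beta> * - a)" by simp
      also have "\<dots> \<le> exp (\<beta> * (a - b)) * exp (\<beta> * - a)"
        using elim by (intro mult_right_mono) auto
      also have "\<dots> = exp (\<beta> * - b)" by (simp add: mult_exp_exp algebra_simps)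
      finally show ?case .
    qed
    ultimately show "\<forall>\<^sub>F \<beta> in at_top. exp (\<beta> * - a) \<le> measure (\<nu> \<beta>) G"
      using eventually_gt_at_top[of 0]
    proof eventually_elim
      case (elim \<beta>)
      interpret prob_space "\<nu> \<beta>" using is_prob elim by auto
      have G: "G \<in> sets (\<nu> \<beta>)" using \<open>open G\<close> sets_eq elim by auto
      have "exp (\<beta> * - b) \<le> (\<integral>x. exp (\<beta> * f x) \<partial>\<nu> \<beta>)"
        unfolding integral_exp_eq[OF elim(3) f] exp_le_cancel_iff
        using elim by (intro mult_left_mono) auto
      also have "\<dots> \<le> (\<integral>x. indicator G x + exp (\<beta> * - M) \<partial>\<nu> \<beta>)"
      proof (intro integral_mono integrable_exp f elim Bochner_Integration.integrable_add)
        fix y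
        have "f y \<le> 0" using r(1) by (simp add: f_def M_def)
        have "f y \<le> - M" if "y \<notin> G"
        proof -
          have "r \<le> dist x y" using that r(2) by (auto simp: not_less)
          then have "M * r \<le> M * dist x y" by (intro mult_left_mono) (auto simp: M_def)
          then show ?thesis using r(1) by (simp add: f_def field_simps)
        qed
        then show "exp (\<beta> * f y) \<le> indicator G y + exp (\<beta> * - M)"
          using elim \<open>f y \<le> 0\<close> mult_left_mono[of "f y" "- M" \<beta>]
          by (cases "y \<in> G") (auto simp: mult_le_0_iff add_increasing2)
      qed (use G in \<open>auto simp: emeasure_eq_measure\<close>)
      also have "\<dots> = measure (\<nu> \<beta>) G + exp (\<beta> * - M)"
        using G elim by (subst Bochner_Integration.integral_add)
          (use prob_space space_eq[OF elim(3)] in \<open>auto simp: emeasure_eq_measure\<close>)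
      finally show ?case using elim by linarith
    qed
  next
    fix K and c c' :: real assume K: "closed K" "\<forall>x\<in>K. ereal c \<le> I x" "c' < c"
    \<comment> \<open>One third of the slack each for the choice of \<open>h x\<close>, for the convergence of the
      functionals, and for the number of sets in the cover.\<close>
    define d where "d = (c - c') / 3"
    have "d > 0" using K by (simp add: d_def)
    have "\<exists>f. continuous_on UNIV f \<and> c - d < f x - \<Lambda> f" if "x \<in> K" for x
    proof -
      have "ereal (c - d) < I x" using K(2) that \<open>d > 0\<close>
        by (metis diff_less_eq less_add_same_cancel1 less_ereal.simps(1) less_le_trans)
      then show ?thesis unfolding I_def less_SUP_iff by auto
    qed
    then obtain h where h: "\<And>x. x \<in> K \<Longrightarrow> continuous_on UNIV (h x)"
        "\<And>x. x \<in> K \<Longrightarrow> c - d < h x x - \<Lambda> (h x)" by metis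
    define U where "U x = {y. c - d + \<Lambda> (h x) < h x y}" for x
    have U: "open (U x)" if "x \<in> K" for x
      unfolding U_def by (intro open_Collect_less continuous_intros h that)
    have "compact K" using compact_space K(1) by (metis compact_Int_closed inf_top_left)
    moreover have "K \<subseteq> (\<Union>x\<in>K. U x)" using h(2) by (fastforce simp: U_def)
    ultimately obtain D where D: "D \<subseteq> K" "finite D" "K \<subseteq> (\<Union>x\<in>D. U x)"
      using U by (metis compactE_image)
    have "\<forall>\<^sub>F \<beta> in at_top. \<forall>x\<in>D. scaled_log_mgf \<nu> \<beta> (h x) < \<Lambda> (h x) + d"
      using D h(1) \<open>d > 0\<close> by (intro eventually_ball_finite ballI order_tendstoD[OF lim]) auto
    moreover have "\<forall>\<^sub>F \<beta> in at_top. real (card D) \<le> exp (\<beta> * d)" using \<open>d > 0\<close> by real_asymp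
    ultimately show "\<forall>\<^sub>F \<beta> in at_top. measure (\<nu> \<beta>) K \<le> exp (\<beta> * - c')"
      using eventually_gt_at_top[of 0]
    proof eventually_elim
      case (elim \<beta>)
      interpret prob_space "\<nu> \<beta>" using is_prob elim by auto
      have US: "U x \<in> sets borel" if "x \<in> D" for x using U D that by auto
      have "measure (\<nu> \<beta>) K \<le> measure (\<nu> \<beta>) (\<Union>x\<in>D. U x)"
        using D US sets_eq[of \<beta>] elim by (intro finite_measure_mono) auto
      also have "\<dots> \<le> (\<Sum>x\<in>D. measure (\<nu> \<beta>) (U x))"
        using D US sets_eq[of \<beta>] elim by (intro finite_measure_subadditive_finite) auto
      also have "\<dots> \<le> (\<Sum>x\<in>D. exp (\<beta> * (2 * d - c)))"
      proof (rule sum_mono)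
        fix x assume "x \<in> D"
        then have x: "x \<in> K" using D by auto
        have "exp (\<beta> * (c - d + \<Lambda> (h x))) * measure (\<nu> \<beta>) (U x) \<le> (\<integral>y. exp (\<beta> * h x y) \<partial>\<nu> \<beta>)"
          using US[OF \<open>x \<in> D\<close>] elim by (intro exp_measure_le_integral h x) (auto simp: U_def)
        also have "\<dots> \<le> exp (\<beta> * (\<Lambda> (h x) + d))"
          using elim \<open>x \<in> D\<close> by (subst integral_exp_eq) (auto intro!: h x less_imp_le)
        also have "\<dots> = exp (\<beta> * (c - d + \<Lambda> (h x))) * exp (\<beta> * (2 * d - c))"
          by (simp add: mult_exp_exp algebra_simps)
        finally show "measure (\<nu> \<beta>) (U x) \<le> exp (\<beta> * (2 * d - c))" by simp
      qed
      also have "\<dots> = real (card D) * exp (\<beta> * (2 * d - c))" by simp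
      also have "\<dots> \<le> exp (\<beta> * d) * exp (\<beta> * (2 * d - c))"
        using elim by (intro mult_right_mono) auto
      also have "\<dots> = exp (\<beta> * - c')" unfolding mult_exp_exp by (simp add: d_def field_simps)
      finally show ?case .
    qed
  qed
  then show ?thesis by (rule ldp_if_exponential_bounds)
qed

end

section \<open>Uniform convergence\<close>

lemma uniform_limit_if_uniformly_Cauchy:
  fixes F :: "real \<Rightarrow> 'b \<Rightarrow> real"
  assumes cauchy: "\<And>e. e > 0 \<Longrightarrow> \<exists>b. \<forall>\<beta>\<ge>b. \<forall>\<gamma>\<ge>b. \<forall>x\<in>S. \<bar>F \<beta> x - F \<gamma> x\<bar> \<le> e"
  shows "\<exists>g. uniform_limit S F g at_top"
proof -
  have "\<exists>l. ((\<lambda>\<beta>. F \<beta> x) \<longlongrightarrow> l) at_top" if "x \<in> S" for x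
  proof -
    have "cauchy_filter (filtermap (\<lambda>\<beta>. F \<beta> x) at_top)"
      unfolding cauchy_filter_metric_filtermap
    proof (intro allI impI)
      fix e :: real assume "e > 0"
      then obtain b where b: "\<forall>\<beta>\<ge>b. \<forall>\<gamma>\<ge>b. \<forall>x\<in>S. \<bar>F \<beta> x - F \<gamma> x\<bar> \<le> e / 2"
        using cauchy[of "e / 2"] by auto
      show "\<exists>P. eventually P at_top \<and> (\<forall>\<beta> \<gamma>. P \<beta> \<and> P \<gamma> \<longrightarrow> dist (F \<beta> x) (F \<gamma> x) < e)"
      proof (intro exI[of _ "\<lambda>\<beta>. b \<le> \<beta>"] conjI allI impI)
        fix \<beta> \<gamma> assume "b \<le> \<beta> \<and> b \<le> \<gamma>"
        then have "\<bar>F \<beta> x - F \<gamma> x\<bar> \<le> e / 2" using b that by blast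
        then show "dist (F \<beta> x) (F \<gamma> x) < e" using \<open>e > 0\<close> by (simp add: dist_real_def)
      qed simp
    qed
    then show ?thesis
      using cauchy_filter_complete_converges[OF _ complete_UNIV, of "filtermap (\<lambda>\<beta>. F \<beta> x) at_top"]
      by (auto simp: filterlim_def filtermap_bot_iff)
  qed
  then obtain g where g: "\<And>x. x \<in> S \<Longrightarrow> ((\<lambda>\<beta>. F \<beta> x) \<longlongrightarrow> g x) at_top" by metis
  have "uniform_limit S F g at_top"
  proof (rule uniform_limitI)
    fix e :: real assume "e > 0"
    then obtain b where b: "\<forall>\<beta>\<ge>b. \<forall>\<gamma>\<ge>b. \<forall>x\<in>S. \<bar>F \<beta> x - F \<gamma> x\<bar> \<le> e / 2"
      using cauchy[of "e / 2"] by auto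
    show "\<forall>\<^sub>F \<beta> in at_top. \<forall>x\<in>S. dist (F \<beta> x) (g x) < e"
      using eventually_ge_at_top[of b]
    proof eventually_elim
      case (elim \<beta>)
      show ?case
      proof
        fix x assume "x \<in> S"
        have "((\<lambda>\<gamma>. \<bar>F \<beta> x - F \<gamma> x\<bar>) \<longlongrightarrow> \<bar>F \<beta> x - g x\<bar>) at_top"
          using g[OF \<open>x \<in> S\<close>] by (intro tendsto_intros)
        moreover have "\<forall>\<^sub>F \<gamma> in at_top. \<bar>F \<beta> x - F \<gamma> x\<bar> \<le> e / 2"
          using eventually_ge_at_top[of b] by eventually_elim (use b elim \<open>x \<in> S\<close> in blast)
        ultimately have "\<bar>F \<beta> x - g x\<bar> \<le> e / 2"
          using tendsto_upperbound by (metis trivial_limit_at_top_linorder)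
        then show "dist (F \<beta> x) (g x) < e" using \<open>e > 0\<close> by (simp add: dist_real_def)
      qed
    qed
  qed
  then show ?thesis by (rule exI[of _ g])
qed

lemma continuous_on_uniform_limit_at_top:
  fixes F :: "real \<Rightarrow> 'b::topological_space \<Rightarrow> real"
  assumes "\<And>\<beta>. \<beta> > 0 \<Longrightarrow> continuous_on S (F \<beta>)" "uniform_limit S F f at_top"
  shows "continuous_on S f"
proof (rule uniform_limit_theorem[OF _ assms(2)])
  show "\<forall>\<^sub>F \<beta> in at_top. continuous_on S (F \<beta>)"
    using eventually_gt_at_top[of 0] by eventually_elim (rule assms(1))
qed simp

text \<open>By equicontinuity a finite net of points of \<open>D\<close> controls all of \<open>S\<close>, and on a finite net the
  pointwise convergence is uniform.\<close>

lemma equicontinuous_uniform_limit: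
  fixes F :: "real \<Rightarrow> 'b::metric_space \<Rightarrow> real"
  assumes "compact S" "D \<subseteq> S" "S \<subseteq> closure D"
    and equi: "\<And>e. e > 0 \<Longrightarrow> \<exists>d>0. \<forall>\<beta>\<ge>start. \<forall>x\<in>S. \<forall>y\<in>S. dist x y < d \<longrightarrow> \<bar>F \<beta> x - F \<beta> y\<bar> \<le> e"
    and lim: "\<And>x. x \<in> D \<Longrightarrow> \<exists>l. ((\<lambda>\<beta>. F \<beta> x) \<longlongrightarrow> l) at_top"
  shows "\<exists>g. uniform_limit S F g at_top"
proof (rule uniform_limit_if_uniformly_Cauchy)
  fix e :: real assume "e > 0"
  then obtain d where d: "d > 0"
    "\<And>\<beta> x y. \<beta> \<ge> start \<Longrightarrow> x \<in> S \<Longrightarrow> y \<in> S \<Longrightarrow> dist x y < d \<Longrightarrow> \<bar>F \<beta> x - F \<beta> y\<bar> \<le> e / 4"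
    using equi[of "e / 4"] by auto
  obtain l where l: "\<And>x. x \<in> D \<Longrightarrow> ((\<lambda>\<beta>. F \<beta> x) \<longlongrightarrow> l x) at_top" using lim by metis
  have "S \<subseteq> (\<Union>x\<in>D. ball x d)"
  proof
    fix x assume "x \<in> S"
    then have "x \<in> closure D" using assms by auto
    then obtain y where "y \<in> D" "dist y x < d" using closure_approachable d(1) by blast
    then show "x \<in> (\<Union>x\<in>D. ball x d)" by auto
  qed
  then obtain E where E: "E \<subseteq> D" "finite E" "S \<subseteq> (\<Union>x\<in>E. ball x d)"
    using compactE_image[OF assms(1), of D "\<lambda>x. ball x d"] by (metis open_ball)
  have "\<forall>\<^sub>F \<beta> in at_top. \<forall>x\<in>E. dist (F \<beta> x) (l x) < e / 4"
    using E \<open>e > 0\<close> by (intro eventually_ball_finite ballI tendstoD[OF l]) auto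
  with eventually_ge_at_top[of start]
  have "\<forall>\<^sub>F \<beta> in at_top. start \<le> \<beta> \<and> (\<forall>x\<in>E. dist (F \<beta> x) (l x) < e / 4)" by eventually_elim simp
  then obtain b where b: "\<And>\<beta>. \<beta> \<ge> b \<Longrightarrow> start \<le> \<beta> \<and> (\<forall>x\<in>E. dist (F \<beta> x) (l x) < e / 4)"
    unfolding eventually_at_top_linorder by blast
  show "\<exists>b. \<forall>\<beta>\<ge>b. \<forall>\<gamma>\<ge>b. \<forall>x\<in>S. \<bar>F \<beta> x - F \<gamma> x\<bar> \<le> e"
  proof (intro exI[of _ b] allI impI ballI)
    fix \<beta> \<gamma> x assume *: "b \<le> \<beta>" "b \<le> \<gamma>" "x \<in> S"
    then obtain y where y: "y \<in> E" "dist y x < d" using E(3) by auto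
    then have "y \<in> S" using E assms by auto
    have "\<bar>F \<beta> y - F \<beta> x\<bar> \<le> e / 4" "\<bar>F \<gamma> y - F \<gamma> x\<bar> \<le> e / 4"
      using d(2) b * y \<open>y \<in> S\<close> by auto
    moreover have "\<bar>F \<beta> y - l y\<bar> < e / 4" "\<bar>F \<gamma> y - l y\<bar> < e / 4"
      using b * y by (auto simp: dist_real_def)
    ultimately show "\<bar>F \<beta> x - F \<gamma> x\<bar> \<le> e" by linarith
  qed
qed

section \<open>Transitive expanding maps\<close>

locale expanding_system =
  fixes T :: "'a::metric_space \<Rightarrow> 'a" and lam eta :: real
  assumes compact_space: "compact (UNIV :: 'a set)"
    and continuous_T: "continuous_on UNIV T"
    and open_image_T: "open U \<Longrightarrow> open (T ` U)"
    and surj_T: "surj T"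
    and transitive: "topologically_transitive T"
    and lam_gt_1: "1 < lam" and eta_pos: "0 < eta"
    and expand: "dist x y \<le> 2 * eta \<Longrightarrow> lam * dist x y \<le> dist (T x) (T y)"
begin

lemma inj_at_small_scale:
  assumes "dist x y \<le> 2 * eta" "T x = T y"
  shows "x = y"
proof -
  have "lam * dist x y \<le> 0" using expand[OF assms(1)] assms(2) by simp
  then show ?thesis using lam_gt_1 by (simp add: mult_le_0_iff)
qed

lemma finite_cover_by_balls:
  assumes "r > 0"
  obtains E :: "'a set" where "finite E" "\<And>x. \<exists>e\<in>E. dist e x < r"
proof -
  have "(UNIV :: 'a set) \<subseteq> (\<Union>x\<in>UNIV. ball x r)" using assms by auto
  then obtain E :: "'a set" where "finite E" "UNIV \<subseteq> (\<Union>x\<in>E. ball x r)"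
    using compactE_image[OF compact_space, of UNIV "\<lambda>x. ball x r"] by auto
  then have "\<exists>e\<in>E. dist e x < r" for x by (auto simp: subset_iff)
  with \<open>finite E\<close> show thesis using that by blast
qed

text \<open>Distinct points of a fibre are more than \<open>2 * eta\<close> apart, so each ball of a finite cover with
  radius \<open>eta\<close> contains at most one of them.\<close>

lemma uniformly_finite_fibres:
  "\<exists>N. \<forall>x. finite (T -` {x}) \<and> card (T -` {x}) \<le> N"
proof -
  obtain E :: "'a set" where E: "finite E" "\<And>x. \<exists>e\<in>E. dist e x < eta"
    using finite_cover_by_balls[OF eta_pos] by blast
  then obtain c where c: "\<And>x. c x \<in> E" "\<And>x. dist (c x) x < eta" by metis
  have inj: "inj_on c (T -` {x})" for x
  proof (rule inj_onI)
    fix y z assume "y \<in> T -` {x}" "z \<in> T -` {x}" "c y = c z"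
    moreover from this have "dist y z \<le> 2 * eta"
      using c(2)[of y] c(2)[of z] dist_triangle3[of y z "c y"] by simp
    ultimately show "y = z" using inj_at_small_scale[of y z] by auto
  qed
  have "finite (T -` {x})" "card (T -` {x}) \<le> card E" for x
    using inj_on_finite[OF inj _ E(1)] card_inj_on_le[OF inj _ E(1)] c(1) by auto
  then show ?thesis by blast
qed

lemma finite_fibre: "finite (T -` {x})"
  using uniformly_finite_fibres by blast

text \<open>Within the radius \<open>\<xi>\<close> every target point near \<open>T y\<close> lifts to a point near \<open>y\<close>, contracted by
  \<open>lam\<close>. The bound \<open>\<xi> \<le> eta\<close> keeps two points of a fibre with a common lift within the scale
  \<open>2 * eta\<close> at which \<open>T\<close> is injective.\<close>

definition inverse_branch_radius :: "real \<Rightarrow> bool" where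
  "inverse_branch_radius \<xi> \<longleftrightarrow> 0 < \<xi> \<and> \<xi> \<le> eta \<and>
     (\<forall>y x'. dist (T y) x' < \<xi> \<longrightarrow> (\<exists>y'. T y' = x' \<and> lam * dist y y' \<le> dist (T y) x'))"

text \<open>Around each point openness of \<open>T\<close> provides lifts within \<open>eta\<close>; compactness makes the radius
  uniform, and expansion improves the crude bound \<open>eta\<close> on the distance to the contraction.\<close>

lemma inverse_branch_radius_exists: "\<exists>\<xi>. inverse_branch_radius \<xi>"
proof -
  have "\<exists>r>0. ball (T y) (2 * r) \<subseteq> T ` ball y (eta / 2)" for y
  proof -
    have "open (T ` ball y (eta / 2))" "T y \<in> T ` ball y (eta / 2)"
      using open_image_T eta_pos by auto
    then obtain s where "s > 0" "ball (T y) s \<subseteq> T ` ball y (eta / 2)" using openE by blast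
    then show ?thesis by (intro exI[of _ "s / 2"]) auto
  qed
  then obtain r where r: "\<And>y. r y > 0" "\<And>y. ball (T y) (2 * r y) \<subseteq> T ` ball y (eta / 2)" by metis
  define V where "V y = ball y (eta / 2) \<inter> T -` ball (T y) (r y)" for y
  have "open (V y)" for y
    unfolding V_def using continuous_T by (intro open_Int open_ball open_vimage)
  moreover have "UNIV \<subseteq> (\<Union>y\<in>UNIV. V y)" using r(1) eta_pos by (auto simp: V_def)
  ultimately obtain E where E: "finite E" "UNIV \<subseteq> (\<Union>y\<in>E. V y)"
    using compactE_image[OF compact_space, of UNIV V] by auto
  define \<xi> where "\<xi> = Min (insert eta (r ` E))"
  have "inverse_branch_radius \<xi>" unfolding inverse_branch_radius_def
  proof (intro conjI allI impI)
    show "0 < \<xi>" "\<xi> \<le> eta" using E(1) r(1) eta_pos by (auto simp: \<xi>_def)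
    fix y x' assume d: "dist (T y) x' < \<xi>"
    obtain e where e: "e \<in> E" "y \<in> V e" using E(2) by auto
    have "\<xi> \<le> r e" using E(1) e(1) by (auto simp: \<xi>_def)
    then have "dist (T e) x' < 2 * r e"
      using e(2) d dist_triangle[of "T e" x' "T y"] by (auto simp: V_def)
    then obtain y' where y': "y' \<in> ball e (eta / 2)" "T y' = x'" using r(2)[of e] by auto
    have "dist y y' \<le> 2 * eta"
      using e(2) y'(1) dist_triangle3[of y y' e] eta_pos by (auto simp: V_def)
    then show "\<exists>y'. T y' = x' \<and> lam * dist y y' \<le> dist (T y) x'"
      using expand[of y y'] y'(2) by blast
  qed
  then show ?thesis by blast
qed

text \<open>Lifting \<open>n\<close> times never increases the distance, so the radius does not shrink with \<open>n\<close>.\<close>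

lemma iterated_inverse_branch:
  assumes \<xi>: "inverse_branch_radius \<xi>" and "dist ((T ^^ n) z) y < \<xi>"
  shows "\<exists>w. (T ^^ n) w = y \<and> dist z w \<le> dist ((T ^^ n) z) y"
  using assms(2)
proof (induction n arbitrary: z)
  case 0
  then show ?case by auto
next
  case (Suc n)
  have eq: "(T ^^ Suc n) x = (T ^^ n) (T x)" for x by (simp only: funpow_Suc_right o_apply)
  from Suc.prems obtain w' where w': "(T ^^ n) w' = y" "dist (T z) w' \<le> dist ((T ^^ Suc n) z) y"
    using Suc.IH[of "T z"] unfolding eq by blast
  then have "dist (T z) w' < \<xi>" using Suc.prems by linarith
  then obtain w where w: "T w = w'" "lam * dist z w \<le> dist (T z) w'"
    using \<xi> unfolding inverse_branch_radius_def by blast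
  have "1 * dist z w \<le> lam * dist z w" using lam_gt_1 by (intro mult_right_mono) auto
  then have "dist z w \<le> dist ((T ^^ Suc n) z) y" using w w' by linarith
  then show ?case using w w' unfolding eq by blast
qed

lemma transitive_points:
  assumes "r > 0"
  obtains n z where "dist x z < r" "dist ((T ^^ n) z) y < r"
proof -
  have "ball x r \<noteq> {}" "ball y r \<noteq> {}" using assms by auto
  then obtain n where "(T ^^ n) ` ball x r \<inter> ball y r \<noteq> {}"
    using transitive unfolding topologically_transitive_def by (meson open_ball)
  then show thesis using that by (auto simp: dist_commute)
qed

text \<open>Only finitely many pairs of balls have to be connected, so the connecting times are bounded.\<close>

lemma uniform_transitivity:
  assumes "r > 0"
  obtains N where "\<And>x y. \<exists>n\<le>N. \<exists>z. dist x z < r \<and> dist ((T ^^ n) z) y < r"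
proof -
  have r: "r / 2 > 0" using assms by simp
  obtain E :: "'a set" where E: "finite E" "\<And>x. \<exists>e\<in>E. dist e x < r / 2"
    using finite_cover_by_balls[OF r] by blast
  have "\<exists>n z. dist x z < r / 2 \<and> dist ((T ^^ n) z) y < r / 2" for x y
    using transitive_points[OF r, of x y] by blast
  then obtain k where k: "\<And>x y. \<exists>z. dist x z < r / 2 \<and> dist ((T ^^ k x y) z) y < r / 2"
    by metis
  define N where "N = Max ((\<lambda>(x, y). k x y) ` (E \<times> E))"
  have "\<exists>n\<le>N. \<exists>z. dist x z < r \<and> dist ((T ^^ n) z) y < r" for x y
  proof -
    obtain e f where ef: "e \<in> E" "dist e x < r / 2" "f \<in> E" "dist f y < r / 2" using E(2) by metis
    obtain z where z: "dist e z < r / 2" "dist ((T ^^ k e f) z) f < r / 2" using k by metis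
    have "k e f \<le> N" unfolding N_def using E(1) ef by (intro Max_ge) auto
    moreover have "dist x z < r" using ef(2) z(1) dist_triangle3[of x z e] by linarith
    moreover have "dist ((T ^^ k e f) z) y < r"
      using ef(4) z(2) dist_triangle[of "(T ^^ k e f) z" y f] by linarith
    ultimately show ?thesis by blast
  qed
  then show thesis using that by blast
qed

text \<open>Transitivity brings a point close to \<open>x\<close> into the vicinity of a given \<open>y\<close>; pulling \<open>y\<close> back
  along that orbit gives a preimage of \<open>y\<close> close to \<open>x\<close>.\<close>

lemma backward_invariant_set_dense:
  assumes "D \<noteq> {}" "\<And>x. T x \<in> D \<Longrightarrow> x \<in> D"
  shows "closure D = UNIV"
proof -
  obtain y where "y \<in> D" using assms by auto
  have preimage: "(T ^^ n) w \<in> D \<Longrightarrow> w \<in> D" for n w by (induction n) (auto intro: assms)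
  obtain \<xi> where \<xi>: "inverse_branch_radius \<xi>" using inverse_branch_radius_exists by auto
  have "\<exists>w\<in>D. dist w x < r" if "r > 0" for x r
  proof -
    define s where "s = min \<xi> (r / 2)"
    have "s > 0" using \<xi> that by (auto simp: s_def inverse_branch_radius_def)
    then obtain n z where z: "dist x z < s" "dist ((T ^^ n) z) y < s" by (rule transitive_points)
    then obtain w where w: "(T ^^ n) w = y" "dist z w \<le> dist ((T ^^ n) z) y"
      using iterated_inverse_branch[OF \<xi>, of n z y] by (auto simp: s_def)
    have "dist x w < s + s" using z w dist_triangle[of x w z] by linarith
    then have "dist w x < r" by (simp add: s_def dist_commute)
    moreover have "w \<in> D" using preimage w(1) \<open>y \<in> D\<close> by blast
    ultimately show ?thesis by blast
  qed
  then show ?thesis by (auto simp: closure_approachable set_eq_iff)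
qed

text \<open>Nearby points have fibres that match point by point. Injectivity of the matching is what allows
  sums over the two fibres to be compared.\<close>

lemma fibre_pairing:
  assumes \<xi>: "inverse_branch_radius \<xi>" and d: "dist x x' < \<xi>"
  obtains p where "inj_on p (T -` {x})" "p ` (T -` {x}) \<subseteq> T -` {x'}"
    "\<And>y. y \<in> T -` {x} \<Longrightarrow> lam * dist y (p y) \<le> dist x x'"
proof -
  have "\<forall>y\<in>T -` {x}. \<exists>y'. T y' = x' \<and> lam * dist y y' \<le> dist x x'"
    using \<xi> d unfolding inverse_branch_radius_def by auto
  then obtain p where p: "\<And>y. y \<in> T -` {x} \<Longrightarrow> T (p y) = x'"
      "\<And>y. y \<in> T -` {x} \<Longrightarrow> lam * dist y (p y) \<le> dist x x'" by metis
  have near: "dist y (p y) \<le> eta" if "y \<in> T -` {x}" for y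
  proof -
    have "1 * dist y (p y) \<le> lam * dist y (p y)" using lam_gt_1 by (intro mult_right_mono) auto
    then show ?thesis using p(2)[OF that] d \<xi> unfolding inverse_branch_radius_def by linarith
  qed
  have "inj_on p (T -` {x})"
  proof (rule inj_onI)
    fix y z assume yz: "y \<in> T -` {x}" "z \<in> T -` {x}" "p y = p z"
    then have "dist y z \<le> 2 * eta"
      using near[OF yz(1)] near[OF yz(2)] dist_triangle2[of y z "p y"] by simp
    then show "y = z" using yz inj_at_small_scale[of y z] by auto
  qed
  then show thesis using p by (intro that[of p]) auto
qed

section \<open>Eigenfunctions of the Ruelle operator\<close>

lemma ruelle_le_if_paired:
  assumes \<xi>: "inverse_branch_radius \<xi>" and d: "dist x x' < \<xi>"
    and f: "\<And>y. 0 \<le> f y" and c: "0 \<le> c"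
    and le: "\<And>y y'. lam * dist y y' \<le> dist x x' \<Longrightarrow> f y * exp (\<phi> y) \<le> c * (f y' * exp (\<phi> y'))"
  shows "ruelle T \<phi> f x \<le> c * ruelle T \<phi> f x'"
proof -
  obtain p where p: "inj_on p (T -` {x})" "p ` (T -` {x}) \<subseteq> T -` {x'}"
    "\<And>y. y \<in> T -` {x} \<Longrightarrow> lam * dist y (p y) \<le> dist x x'" using fibre_pairing[OF \<xi> d] by blast
  have "ruelle T \<phi> f x \<le> (\<Sum>y\<in>T -` {x}. c * (f (p y) * exp (\<phi> (p y))))"
    unfolding ruelle_def by (intro sum_mono le p(3))
  also have "\<dots> = c * (\<Sum>y'\<in>p ` (T -` {x}). f y' * exp (\<phi> y'))"
    by (simp add: sum.reindex[OF p(1)] sum_distrib_left)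
  also have "\<dots> \<le> c * ruelle T \<phi> f x'" unfolding ruelle_def
    using c f p(2) finite_fibre by (intro mult_left_mono sum_mono2) auto
  finally show ?thesis .
qed

text \<open>One application of the operator replaces \<open>x, x'\<close> by preimages that are closer by the factor
  \<open>lam\<close>, at the price of \<open>H * dist powr \<alpha>\<close> from the potential. Iterating, these prices form a
  geometric series with sum \<open>H / (lam powr \<alpha> - 1)\<close> times \<open>dist x x' powr \<alpha>\<close>, and what remains is the
  oscillation of \<open>ln f\<close> at scale \<open>0\<close>, which vanishes by uniform continuity. The constant is linear
  in \<open>H\<close>, hence of order \<open>\<beta>\<close> for the potential \<open>\<beta> A\<close>.\<close>

lemma eigenfunction_distortion:
  fixes E :: real
  assumes \<xi>: "inverse_branch_radius \<xi>" and \<alpha>: "0 < \<alpha>" and H: "0 \<le> H"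
    and \<phi>: "\<And>x y. \<bar>\<phi> x - \<phi> y\<bar> \<le> H * dist x y powr \<alpha>"
    and f: "continuous_on UNIV f" "\<And>x. 0 < f x"
    and E: "0 < E" "\<And>x. ruelle T \<phi> f x = E * f x"
    and d: "dist x x' < \<xi>"
  shows "ln (f x) - ln (f x') \<le> H / (lam powr \<alpha> - 1) * dist x x' powr \<alpha>"
proof -
  define C where "C = H / (lam powr \<alpha> - 1)"
  have lama: "1 < lam powr \<alpha>" using lam_gt_1 \<alpha> by simp
  have C: "0 \<le> C" "C + H = C * lam powr \<alpha>" using H lama by (auto simp: C_def field_simps)
  have "ln (f x) - ln (f x') \<le> C * dist x x' powr \<alpha> + e" if "e > 0" for e
  proof -
    have "uniformly_continuous_on UNIV (\<lambda>x. ln (f x))"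
      using f(2) by (intro compact_uniformly_continuous compact_space continuous_on_ln f(1))
        (auto simp: less_imp_neq[symmetric])
    then obtain \<delta> where \<delta>: "\<delta> > 0" "\<And>x x'. dist x x' < \<delta> \<Longrightarrow> dist (ln (f x)) (ln (f x')) < e"
      using \<open>e > 0\<close> unfolding uniformly_continuous_on_def by (metis UNIV_I)
    \<comment> \<open>Induction over the scale: points at distance below \<open>\<delta>\<close> are settled by uniform
      continuity, and each step enlarges the scale by the factor \<open>lam\<close>.\<close>
    have "f x \<le> exp (e + C * dist x x' powr \<alpha>) * f x'"
      if "dist x x' < \<xi>" "dist x x' < \<delta> * lam ^ n" for n x x'
      using that
    proof (induction n arbitrary: x x')
      case 0
      then have "ln (f x) - ln (f x') \<le> e" using \<delta>(2)[of x x'] by (simp add: dist_real_def)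
      moreover have "0 \<le> C * dist x x' powr \<alpha>" using C(1) by simp
      ultimately have "ln (f x) \<le> e + C * dist x x' powr \<alpha> + ln (f x')" by linarith
      then have "exp (ln (f x)) \<le> exp (e + C * dist x x' powr \<alpha> + ln (f x'))"
        by (simp only: exp_le_cancel_iff)
      then show ?case using f(2) by (simp add: exp_add)
    next
      case (Suc n)
      define s where "s = dist x x' powr \<alpha>"
      have "E * f x \<le> exp (e + C * s) * (E * f x')"
        unfolding E(2)[symmetric]
      proof (rule ruelle_le_if_paired[OF \<xi> Suc.prems(1)])
        fix y y' :: 'a assume le: "lam * dist y y' \<le> dist x x'"
        have "1 * dist y y' \<le> lam * dist y y'" using lam_gt_1 by (intro mult_right_mono) auto
        then have "dist y y' < \<xi>" using le Suc.prems(1) by linarith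
        moreover have "lam * dist y y' < lam * (\<delta> * lam ^ n)"
          using le Suc.prems(2) by (simp add: algebra_simps)
        then have "dist y y' < \<delta> * lam ^ n" using lam_gt_1 by simp
        ultimately have IH: "f y \<le> exp (e + C * dist y y' powr \<alpha>) * f y'" by (rule Suc.IH)
        have "\<phi> y \<le> \<phi> y' + H * dist y y' powr \<alpha>" using \<phi>[of y y'] by linarith
        then have "exp (\<phi> y) \<le> exp (H * dist y y' powr \<alpha>) * exp (\<phi> y')"
          unfolding mult_exp_exp exp_le_cancel_iff by linarith
        then have "f y * exp (\<phi> y)
            \<le> (exp (e + C * dist y y' powr \<alpha>) * f y') * (exp (H * dist y y' powr \<alpha>) * exp (\<phi> y'))"
          using IH f(2)[of y'] by (intro mult_mono) auto
        also have "\<dots> = exp (e + (C + H) * dist y y' powr \<alpha>) * (f y' * exp (\<phi> y'))"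
          by (simp add: exp_add distrib_right)
        also have "\<dots> \<le> exp (e + C * s) * (f y' * exp (\<phi> y'))"
        proof (intro mult_right_mono)
          have "(C + H) * dist y y' powr \<alpha> = C * (lam * dist y y') powr \<alpha>"
            using lam_gt_1 by (simp add: C(2) powr_mult)
          also have "\<dots> \<le> C * s" unfolding s_def
            using le lam_gt_1 \<alpha> C(1) by (intro mult_left_mono powr_mono2) auto
          finally show "exp (e + (C + H) * dist y y' powr \<alpha>) \<le> exp (e + C * s)" by simp
        qed (use f(2)[of y'] in auto)
        finally show "f y * exp (\<phi> y) \<le> exp (e + C * s) * (f y' * exp (\<phi> y'))" .
      qed (auto intro: less_imp_le f)
      then show ?case using E(1) by (simp add: s_def)
    qed
    moreover obtain n where "dist x x' / \<delta> < lam ^ n" using real_arch_pow[OF lam_gt_1] by blast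
    ultimately have "f x \<le> exp (e + C * dist x x' powr \<alpha>) * f x'"
      using d \<delta>(1) by (simp add: field_simps)
    then have "ln (f x) \<le> ln (exp (e + C * dist x x' powr \<alpha>) * f x')"
      using f(2) by (intro ln_mono) auto
    also have "\<dots> = e + C * dist x x' powr \<alpha> + ln (f x')" using f(2)[of x'] by (subst ln_mult_pos) auto
    finally show ?thesis by simp
  qed
  then have "ln (f x) - ln (f x') \<le> C * dist x x' powr \<alpha>" by (rule field_le_epsilon)
  then show ?thesis by (simp add: C_def)
qed

text \<open>The eigenvalue equation is evaluated at a minimum and at a maximum of \<open>f\<close>.\<close>

lemma eigenvalue_bounds:
  fixes E B :: real and N :: nat
  assumes N: "\<And>x. card (T -` {x}) \<le> N" and B: "\<And>x. \<bar>\<phi> x\<bar> \<le> B"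
    and f: "continuous_on UNIV f" "\<And>x. 0 < f x" and E: "\<And>x. ruelle T \<phi> f x = E * f x"
  shows "exp (- B) \<le> E" "E \<le> real N * exp B"
proof -
  obtain x where x: "\<And>y. f x \<le> f y"
    using continuous_attains_inf[OF compact_space _ f(1)] by auto
  obtain y where y: "T y = x" using surj_T by (metis surjD)
  have "exp (- B) * f x \<le> f y * exp (\<phi> y)"
    using x[of y] B[of y] f(2)[of x] f(2)[of y] by (subst mult.commute, intro mult_mono) (auto simp: abs_le_iff)
  also have "\<dots> \<le> (\<Sum>y\<in>T -` {x}. f y * exp (\<phi> y))"
    using y finite_fibre f(2) by (intro member_le_sum) (auto intro: less_imp_le)
  also have "\<dots> = E * f x" using E[of x] by (simp add: ruelle_def)
  finally show "exp (- B) \<le> E" using f(2)[of x] by simp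
  obtain x where x: "\<And>y. f y \<le> f x"
    using continuous_attains_sup[OF compact_space _ f(1)] by auto
  have "E * f x = (\<Sum>y\<in>T -` {x}. f y * exp (\<phi> y))" using E[of x] by (simp add: ruelle_def)
  also have "\<dots> \<le> (\<Sum>y\<in>T -` {x}. f x * exp B)"
    using x B f(2) by (intro sum_mono mult_mono) (auto simp: abs_le_iff intro: less_imp_le)
  also have "\<dots> \<le> real N * (f x * exp B)" using N[of x] f(2)[of x] by (simp add: mult_right_mono)
  finally show "E \<le> real N * exp B" using f(2)[of x] by (simp add: mult.assoc mult.left_commute)
qed

end

section \<open>Estimates uniform in the inverse temperature\<close>

lemma holder_modulus:
  fixes H \<alpha> :: real
  assumes "0 < \<alpha>" "0 \<le> H" "0 < e"
  obtains d where "d > 0" "\<And>s. 0 \<le> s \<Longrightarrow> s < d \<Longrightarrow> H * s powr \<alpha> \<le> e"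
proof -
  define d where "d = (e / (H + 1)) powr (1 / \<alpha>)"
  have "d > 0" using assms by (simp add: d_def)
  moreover have "H * s powr \<alpha> \<le> e" if "0 \<le> s" "s < d" for s
  proof -
    have "s powr \<alpha> \<le> d powr \<alpha>" using that assms(1) by (intro powr_mono2) auto
    also have "\<dots> = e / (H + 1)" using assms by (simp add: d_def powr_powr)
    finally have "(H + 1) * s powr \<alpha> \<le> e" using assms by (simp add: field_simps)
    moreover have "H * s powr \<alpha> \<le> (H + 1) * s powr \<alpha>" by (intro mult_right_mono) auto
    ultimately show ?thesis by linarith
  qed
  ultimately show thesis using that by blast
qed

locale zero_temperature = expanding_system T lam eta
  for T :: "'a::metric_space \<Rightarrow> 'a" and lam eta :: real +
  fixes A :: "'a \<Rightarrow> real" and \<alpha> H :: real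
    and m \<mu> :: "real \<Rightarrow> 'a measure" and u :: "real \<Rightarrow> 'a \<Rightarrow> real"
  assumes alpha_pos: "0 < \<alpha>" and H_nonneg: "0 \<le> H"
    and holder: "\<bar>A x - A y\<bar> \<le> H * dist x y powr \<alpha>"
    and eigenmeasure: "\<beta> > 0 \<Longrightarrow> ruelle_eigenmeasure T (\<lambda>x. \<beta> * A x) (m \<beta>)"
    and eigenfunction: "\<beta> > 0 \<Longrightarrow> ruelle_eigenfunction T (\<lambda>x. \<beta> * A x) (m \<beta>) (u \<beta>)"
    and density: "\<beta> > 0 \<Longrightarrow> \<mu> \<beta> = density (m \<beta>) (\<lambda>x. ennreal (u \<beta> x))"
    and borel_prob_mu: "\<beta> > 0 \<Longrightarrow> borel_prob (\<mu> \<beta>)"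
begin

sublocale mu: compact_prob_family \<mu>
  by unfold_locales (use compact_space borel_prob_mu in auto)

sublocale m: compact_prob_family m
  by unfold_locales (use compact_space eigenmeasure in \<open>auto simp: ruelle_eigenmeasure_def\<close>)

definition P :: "real \<Rightarrow> real" where "P \<beta> = pressure T (\<lambda>x. \<beta> * A x)"
definition W :: "real \<Rightarrow> 'a \<Rightarrow> real" where "W \<beta> x = (1 / \<beta>) * ln (u \<beta> x)"
definition G :: "real \<Rightarrow> 'a \<Rightarrow> real" where
  "G \<beta> x = normalized_potential T (\<lambda>y. \<beta> * A y) (u \<beta>) x / \<beta>"

lemma u_continuous: "\<beta> > 0 \<Longrightarrow> continuous_on UNIV (u \<beta>)"
  and u_pos: "\<beta> > 0 \<Longrightarrow> 0 < u \<beta> x"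
  and u_eigen: "\<beta> > 0 \<Longrightarrow> ruelle T (\<lambda>x. \<beta> * A x) (u \<beta>) x = exp (P \<beta>) * u \<beta> x"
  using eigenfunction[of \<beta>] unfolding ruelle_eigenfunction_def P_def by auto

lemma W_continuous: "\<beta> > 0 \<Longrightarrow> continuous_on UNIV (W \<beta>)"
  unfolding W_def using u_continuous u_pos
  by (intro continuous_intros) (auto simp: less_imp_neq[symmetric])

lemma exp_W: "\<beta> > 0 \<Longrightarrow> exp (\<beta> * W \<beta> x) = u \<beta> x"
  using u_pos[of \<beta> x] by (simp add: W_def)

lemma G_eq: "\<beta> > 0 \<Longrightarrow> G \<beta> x = A x + W \<beta> x - W \<beta> (T x) - P \<beta> / \<beta>"
  by (simp add: G_def W_def P_def normalized_potential_def field_simps)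

lemma A_modulus:
  assumes "e > 0"
  obtains d where "d > 0" "\<And>x y. dist x y < d \<Longrightarrow> \<bar>A x - A y\<bar> \<le> e"
proof -
  obtain d where "d > 0" "\<And>s. 0 \<le> s \<Longrightarrow> s < d \<Longrightarrow> H * s powr \<alpha> \<le> e"
    using holder_modulus[OF alpha_pos H_nonneg assms] by blast
  then show thesis using order_trans[OF holder] by (intro that[of d]) auto
qed

lemma A_continuous: "continuous_on UNIV A"
  unfolding continuous_on_iff
proof (intro ballI allI impI)
  fix x and e :: real assume "e > 0"
  then obtain d where "d > 0" "\<And>x y. dist x y < d \<Longrightarrow> \<bar>A x - A y\<bar> \<le> e / 2"
    using A_modulus[of "e / 2"] by auto
  then show "\<exists>d>0. \<forall>x'\<in>UNIV. dist x' x < d \<longrightarrow> dist (A x') (A x) < e"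
    using \<open>e > 0\<close> by (intro exI[of _ d]) (fastforce simp: dist_real_def)
qed

lemma W_modulus:
  assumes "e > 0"
  obtains d where "d > 0" "\<And>\<beta> x y. \<beta> > 0 \<Longrightarrow> dist x y < d \<Longrightarrow> \<bar>W \<beta> x - W \<beta> y\<bar> \<le> e"
proof -
  obtain \<xi> where \<xi>: "inverse_branch_radius \<xi>" using inverse_branch_radius_exists by auto
  define C where "C = H / (lam powr \<alpha> - 1)"
  have "1 < lam powr \<alpha>" using lam_gt_1 alpha_pos by simp
  then have C: "0 \<le> C" using H_nonneg by (simp add: C_def)
  obtain d where d: "d > 0" "\<And>s. 0 \<le> s \<Longrightarrow> s < d \<Longrightarrow> C * s powr \<alpha> \<le> e"
    using holder_modulus[OF alpha_pos C assms] by blast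
  have le: "W \<beta> x - W \<beta> y \<le> e" if "\<beta> > 0" "dist x y < min \<xi> d" for \<beta> x y
  proof -
    have "ln (u \<beta> x) - ln (u \<beta> y) \<le> \<beta> * H / (lam powr \<alpha> - 1) * dist x y powr \<alpha>"
    proof (rule eigenfunction_distortion[OF \<xi> alpha_pos, where E = "exp (P \<beta>)" and \<phi> = "\<lambda>x. \<beta> * A x"])
      show "\<bar>\<beta> * A x - \<beta> * A y\<bar> \<le> \<beta> * H * dist x y powr \<alpha>" for x y
        using that(1) mult_left_mono[OF holder[of x y], of \<beta>]
        by (simp add: abs_mult mult.assoc flip: right_diff_distrib)
    qed (use that H_nonneg u_continuous u_pos u_eigen in auto)
    also have "\<dots> \<le> \<beta> * e"
      using that d(2)[of "dist x y"] mult_left_mono[of "C * dist x y powr \<alpha>" e \<beta>]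
      by (simp add: C_def mult.assoc)
    finally show ?thesis using that(1) by (simp add: W_def field_simps)
  qed
  show thesis
  proof (rule that[of "min \<xi> d"])
    show "min \<xi> d > 0" using \<xi> d by (simp add: inverse_branch_radius_def)
    show "\<bar>W \<beta> x - W \<beta> y\<bar> \<le> e" if "\<beta> > 0" "dist x y < min \<xi> d" for \<beta> x y
      using le[OF that] le[of \<beta> y x] that by (simp add: dist_commute abs_le_iff)
  qed
qed

text \<open>The eigenvalue bounds give \<open>\<bar>P(\<beta>A)\<bar> \<le> ln N + \<beta> sup \<bar>A\<bar>\<close>; with \<open>N\<close> a bound for the size
  of the fibres; dividing by \<open>\<beta> \<ge> 1\<close> removes the growth.\<close>

lemma pressure_bounded:
  obtains C where "\<And>\<beta>. \<beta> \<ge> 1 \<Longrightarrow> \<bar>P \<beta> / \<beta>\<bar> \<le> C"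
proof -
  obtain B where "B > 0" and B: "\<And>x. \<bar>A x\<bar> \<le> B" using mu.continuous_bounded[OF A_continuous] by blast
  obtain N where N: "\<And>x. finite (T -` {x})" "\<And>x. card (T -` {x}) \<le> N"
    using uniformly_finite_fibres by blast
  have "\<bar>P \<beta> / \<beta>\<bar> \<le> ln (real N) + B" if "\<beta> \<ge> 1" for \<beta>
  proof -
    have pos: "\<beta> > 0" using that by simp
    have bd: "\<bar>\<beta> * A x\<bar> \<le> \<beta> * B" for x using B[of x] pos by (simp add: abs_mult)
    have lo: "exp (- (\<beta> * B)) \<le> exp (P \<beta>)" and up: "exp (P \<beta>) \<le> real N * exp (\<beta> * B)"
      using eigenvalue_bounds[OF N(2) bd u_continuous[OF pos] u_pos[OF pos] u_eigen[OF pos]] by auto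
    have "0 < real N * exp (\<beta> * B)" using up exp_gt_zero[of "P \<beta>"] by linarith
    then have "N \<ge> 1" by (simp add: zero_less_mult_iff)
    have "ln (exp (P \<beta>)) \<le> ln (real N * exp (\<beta> * B))" using up by (intro ln_mono) auto
    then have "P \<beta> \<le> ln (real N) + \<beta> * B" using \<open>N \<ge> 1\<close> by (simp add: ln_mult_pos)
    moreover have "ln (real N) \<le> \<beta> * ln (real N)"
      using that \<open>N \<ge> 1\<close> mult_right_mono[of 1 \<beta> "ln (real N)"] by simp
    ultimately have 1: "P \<beta> \<le> (ln (real N) + B) * \<beta>" by (simp add: algebra_simps)
    have "0 \<le> \<beta> * ln (real N)" using \<open>N \<ge> 1\<close> pos by simp
    then have 2: "- ((ln (real N) + B) * \<beta>) \<le> P \<beta>"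
      using lo by (simp add: algebra_simps)
    have "\<bar>P \<beta>\<bar> \<le> (ln (real N) + B) * \<beta>" using 1 2 by linarith
    then show ?thesis using pos by (simp add: field_simps)
  qed
  then show thesis using that by blast
qed

text \<open>A single term of the eigenvalue equation gives a lower bound for \<open>W (T x) - W x\<close>. Two arbitrary
  points are joined, up to small errors, by an orbit segment of bounded length.\<close>

lemma W_oscillation_bounded:
  obtains C where "\<And>\<beta> x y. \<beta> \<ge> 1 \<Longrightarrow> \<bar>W \<beta> x - W \<beta> y\<bar> \<le> C"
proof -
  obtain B where B: "\<And>x. \<bar>A x\<bar> \<le> B" using mu.continuous_bounded[OF A_continuous] by blast
  obtain C where C: "\<And>\<beta>. \<beta> \<ge> 1 \<Longrightarrow> \<bar>P \<beta> / \<beta>\<bar> \<le> C" using pressure_bounded by blast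
  have BC: "0 \<le> B + C" 
    using order_trans[OF abs_ge_zero B] order_trans[OF abs_ge_zero C[of 1]] by simp
  obtain d where d: "d > 0" "\<And>\<beta> x y. \<beta> > 0 \<Longrightarrow> dist x y < d \<Longrightarrow> \<bar>W \<beta> x - W \<beta> y\<bar> \<le> 1"
    using W_modulus[of 1] by auto
  obtain N where N: "\<And>x y. \<exists>n\<le>N. \<exists>z. dist x z < d \<and> dist ((T ^^ n) z) y < d"
    using uniform_transitivity[OF d(1)] by blast
  have le: "W \<beta> x - W \<beta> y \<le> 2 + real N * (B + C)" if "\<beta> \<ge> 1" for \<beta> x y
  proof -
    have pos: "\<beta> > 0" using that by simp
    have step: "W \<beta> x \<le> W \<beta> (T x) + (B + C)" for x
    proof -
      have "u \<beta> x * exp (\<beta> * A x) \<le> ruelle T (\<lambda>x. \<beta> * A x) (u \<beta>) (T x)"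
        unfolding ruelle_def using u_pos[OF pos] finite_fibre
        by (intro member_le_sum) (auto intro: less_imp_le)
      also have "\<dots> = exp (P \<beta>) * u \<beta> (T x)" by (rule u_eigen[OF pos])
      finally have "exp (\<beta> * (W \<beta> x + A x)) \<le> exp (\<beta> * (P \<beta> / \<beta> + W \<beta> (T x)))"
        using pos by (simp add: distrib_left exp_add exp_W)
      then have "W \<beta> x + A x \<le> P \<beta> / \<beta> + W \<beta> (T x)" using pos by simp
      then show ?thesis using B[of x] C[OF that] by linarith
    qed
    have steps: "W \<beta> x \<le> W \<beta> ((T ^^ n) x) + real n * (B + C)" for n x
    proof (induction n)
      case (Suc n)
      then show ?case using step[of "(T ^^ n) x"] by (simp add: distrib_right)
    qed simp
    obtain n z where z: "n \<le> N" "dist x z < d" "dist ((T ^^ n) z) y < d" using N by blast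
    have "real n * (B + C) \<le> real N * (B + C)" using z(1) BC by (intro mult_right_mono) auto
    then show ?thesis using steps[of z n] d(2)[OF pos z(2)] d(2)[OF pos z(3)] by linarith
  qed
  then have "\<bar>W \<beta> x - W \<beta> y\<bar> \<le> 2 + real N * (B + C)" if "\<beta> \<ge> 1" for \<beta> x y
    using le[OF that, of x y] le[OF that, of y x] by linarith
  then show thesis using that by blast
qed

lemma G_bounded:
  obtains C where "\<And>\<beta> x. \<beta> \<ge> 1 \<Longrightarrow> \<bar>G \<beta> x\<bar> \<le> C"
proof -
  obtain B where B: "\<And>x. \<bar>A x\<bar> \<le> B" using mu.continuous_bounded[OF A_continuous] by blast
  obtain C where C: "\<And>\<beta>. \<beta> \<ge> 1 \<Longrightarrow> \<bar>P \<beta> / \<beta>\<bar> \<le> C" using pressure_bounded by blast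
  obtain D where D: "\<And>\<beta> x y. \<beta> \<ge> 1 \<Longrightarrow> \<bar>W \<beta> x - W \<beta> y\<bar> \<le> D" using W_oscillation_bounded by blast
  have "\<bar>G \<beta> x\<bar> \<le> B + C + D" if "\<beta> \<ge> 1" for \<beta> x
    using B[of x] C[OF that] D[OF that, of x "T x"] G_eq[of \<beta> x] that by linarith
  then show thesis using that by blast
qed

lemma G_modulus:
  assumes "e > 0"
  obtains d where "d > 0" "\<And>\<beta> x y. \<beta> > 0 \<Longrightarrow> dist x y < d \<Longrightarrow> \<bar>G \<beta> x - G \<beta> y\<bar> \<le> e"
proof -
  have e: "e / 3 > 0" using assms by simp
  obtain a where a: "a > 0" "\<And>x y. dist x y < a \<Longrightarrow> \<bar>A x - A y\<bar> \<le> e / 3"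
    using A_modulus[OF e] by blast
  obtain w where w: "w > 0" "\<And>\<beta> x y. \<beta> > 0 \<Longrightarrow> dist x y < w \<Longrightarrow> \<bar>W \<beta> x - W \<beta> y\<bar> \<le> e / 3"
    using W_modulus[OF e] by blast
  have "uniformly_continuous_on UNIV T"
    by (intro compact_uniformly_continuous compact_space continuous_T)
  then obtain t where t: "t > 0" "\<And>x y. dist x y < t \<Longrightarrow> dist (T x) (T y) < w"
    using w(1) unfolding uniformly_continuous_on_def by (metis UNIV_I)
  show thesis
  proof (rule that[of "min a (min w t)"])
    fix \<beta> :: real and x y :: 'a assume *: "0 < \<beta>" "dist x y < min a (min w t)"
    then have "\<bar>A x - A y\<bar> \<le> e / 3" "\<bar>W \<beta> x - W \<beta> y\<bar> \<le> e / 3" "\<bar>W \<beta> (T x) - W \<beta> (T y)\<bar> \<le> e / 3"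
      using a w t by auto
    then show "\<bar>G \<beta> x - G \<beta> y\<bar> \<le> e" unfolding G_eq[OF *(1)] by linarith
  qed (use a w t in auto)
qed

section \<open>The Jacobian of the equilibrium states\<close>

text \<open>The equation for the eigenmeasure yields integrability for free: a non-integrable function has
  Bochner integral zero, which is impossible for the image of a function that is at least \<open>1\<close>. The
  general case is a difference of two such images.\<close>

lemma integrable_ruelle:
  assumes "\<beta> > 0" "continuous_on UNIV w"
  shows "integrable (m \<beta>) (ruelle T (\<lambda>x. \<beta> * A x) w)"
proof -
  interpret prob_space "m \<beta>" using m.is_prob assms by auto
  let ?R = "ruelle T (\<lambda>x. \<beta> * A x)"
  have int: "integrable (m \<beta>) (?R v)" if v: "continuous_on UNIV v" "\<And>x. 1 \<le> v x" for v
  proof (rule ccontr)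
    assume "\<not> ?thesis"
    then have "(\<integral>x. ?R v x \<partial>m \<beta>) = 0" by (rule not_integrable_integral_eq)
    then have "(\<integral>x. v x \<partial>m \<beta>) = 0"
      using eigenmeasure[OF assms(1)] v(1) by (simp add: ruelle_eigenmeasure_def)
    moreover have "(\<integral>x. 1 \<partial>m \<beta>) \<le> (\<integral>x. v x \<partial>m \<beta>)"
      using m.integrable_continuous[OF assms(1) v(1)] v(2) by (intro integral_mono) auto
    ultimately show False by (simp add: prob_space)
  qed
  obtain B where "B > 0" and B: "\<And>x. \<bar>w x\<bar> \<le> B" using m.continuous_bounded[OF assms(2)] by blast
  have ge: "1 \<le> w x + (B + 1)" for x using B[of x] by linarith
  have "?R w = (\<lambda>x. ?R (\<lambda>x. w x + (B + 1)) x - (B + 1) * ?R (\<lambda>x. 1) x)"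
    by (simp add: fun_eq_iff ruelle_def distrib_right sum.distrib sum_distrib_left)
  moreover have "integrable (m \<beta>) (?R (\<lambda>x. w x + (B + 1)))"
    using ge by (intro int continuous_intros assms) auto
  moreover have "integrable (m \<beta>) (?R (\<lambda>x. 1))" by (intro int continuous_intros) auto
  ultimately show ?thesis
    using Bochner_Integration.integrable_diff[OF _ integrable_mult_right] by simp
qed

lemma integral_mu:
  assumes "\<beta> > 0" "v \<in> borel_measurable borel"
  shows "(\<integral>x. v x \<partial>\<mu> \<beta>) = (\<integral>x. u \<beta> x * v x \<partial>m \<beta>)"
proof -
  have "u \<beta> \<in> borel_measurable (m \<beta>)"
    using borel_measurable_continuous_onI[OF u_continuous[OF assms(1)]]
    by (simp add: measurable_cong_sets[OF m.sets_eq[OF assms(1)] refl])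
  moreover have "v \<in> borel_measurable (m \<beta>)"
    using assms(2) by (simp add: measurable_cong_sets[OF m.sets_eq[OF assms(1)] refl])
  ultimately show ?thesis unfolding density[OF assms(1)]
    using u_pos[OF assms(1)] by (subst integral_density) (auto intro: less_imp_le)
qed

lemma measure_mu:
  assumes "\<beta> > 0" "S \<in> sets borel"
  shows "measure (\<mu> \<beta>) S = (\<integral>x. u \<beta> x * indicator S x \<partial>m \<beta>)"
    and "integrable (m \<beta>) (\<lambda>x. u \<beta> x * indicator S x)"
proof -
  have S: "S \<in> sets (m \<beta>)" "S \<in> sets (\<mu> \<beta>)"
    using m.sets_eq mu.sets_eq assms by auto
  show "measure (\<mu> \<beta>) S = (\<integral>x. u \<beta> x * indicator S x \<partial>m \<beta>)"
    using S assms by (simp flip: integral_mu add: mu.space_eq)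
  show "integrable (m \<beta>) (\<lambda>x. u \<beta> x * indicator S x)"
    using S m.integrable_continuous[OF assms(1) u_continuous[OF assms(1)]]
    by (intro integrable_real_mult_indicator) auto
qed

text \<open>Conjugation by \<open>u\<close> turns the eigenmeasure equation into invariance of \<open>\<mu>\<close> under the adjoint
  of the Ruelle operator of the normalized potential, here expressed through \<open>m\<close>.\<close>

lemma transfer_identity:
  assumes "\<beta> > 0" "continuous_on UNIV v"
  defines "R \<equiv> ruelle T (\<lambda>x. \<beta> * G \<beta> x) v"
  shows "integrable (m \<beta>) (\<lambda>x. u \<beta> x * R x)"
    and "(\<integral>x. u \<beta> x * R x \<partial>m \<beta>) = (\<integral>x. u \<beta> x * v x \<partial>m \<beta>)"
proof -
  let ?w = "\<lambda>x. u \<beta> x * v x"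
  have w: "continuous_on UNIV ?w" by (intro continuous_intros u_continuous assms)
  have eq: "ruelle T (\<lambda>x. \<beta> * A x) ?w x = exp (P \<beta>) * (u \<beta> x * R x)" for x
  proof -
    have "exp (\<beta> * A y) * u \<beta> y = exp (P \<beta>) * u \<beta> x * exp (\<beta> * G \<beta> y)" if "T y = x" for y
    proof -
      have "\<beta> * A y + \<beta> * W \<beta> y = P \<beta> + \<beta> * W \<beta> x + \<beta> * G \<beta> y"
        unfolding G_eq[OF assms(1)] that using assms(1) by (simp add: field_simps)
      then have "exp (\<beta> * A y + \<beta> * W \<beta> y) = exp (P \<beta> + \<beta> * W \<beta> x + \<beta> * G \<beta> y)" by simp
      then show ?thesis using assms(1) by (simp add: exp_add exp_W)
    qed
    then have "u \<beta> y * v y * exp (\<beta> * A y) = exp (P \<beta>) * u \<beta> x * (v y * exp (\<beta> * G \<beta> y))"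
      if "T y = x" for y using that by (metis (no_types, lifting) mult.assoc mult.commute)
    then show ?thesis
      unfolding ruelle_def R_def sum_distrib_left by (intro sum.cong) (auto simp: mult.assoc)
  qed
  have "integrable (m \<beta>) (\<lambda>x. exp (P \<beta>) * (u \<beta> x * R x))"
    using integrable_ruelle[OF assms(1) w] unfolding eq[symmetric] .
  then show "integrable (m \<beta>) (\<lambda>x. u \<beta> x * R x)" by simp
  have "exp (P \<beta>) * (\<integral>x. u \<beta> x * R x \<partial>m \<beta>) = exp (P \<beta>) * (\<integral>x. u \<beta> x * v x \<partial>m \<beta>)"
    using eigenmeasure[OF assms(1)] w
    by (simp add: ruelle_eigenmeasure_def flip: P_def eq integral_mult_right_zero)
  then show "(\<integral>x. u \<beta> x * R x \<partial>m \<beta>) = (\<integral>x. u \<beta> x * v x \<partial>m \<beta>)" by simp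
qed

text \<open>A tent function between the indicator of a ball and that of the ball of twice the radius. The
  eigenmeasure equation speaks of continuous functions only, so balls enter through it.\<close>

definition bump :: "'a \<Rightarrow> real \<Rightarrow> 'a \<Rightarrow> real" where
  "bump x r y = max 0 (min 1 (2 - dist x y / r))"

lemma bump:
  assumes "r > 0"
  shows "continuous_on UNIV (bump x r)" "0 \<le> bump x r y" "bump x r y \<le> 1"
    and "y \<in> ball x r \<Longrightarrow> bump x r y = 1" "y \<notin> cball x (2 * r) \<Longrightarrow> bump x r y = 0"
proof -
  show "continuous_on UNIV (bump x r)"
    unfolding bump_def using assms by (intro continuous_intros) auto
qed (use assms in \<open>auto simp: bump_def field_simps\<close>)

text \<open>One of the two halves of the Jacobian formula: a point in the image of the ball has at least one
  preimage where the tent function is \<open>1\<close>.\<close>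

lemma measure_image_ball_le:
  assumes "\<beta> > 0" "r > 0" and c: "\<And>y. y \<in> cball x (2 * r) \<Longrightarrow> c \<le> G \<beta> y"
  shows "exp (\<beta> * c) * measure (\<mu> \<beta>) (T ` ball x r) \<le> measure (\<mu> \<beta>) (cball x (2 * r))"
proof -
  let ?v = "bump x r" and ?B = "T ` ball x r"
  note v = bump[OF assms(2), where x = x]
  let ?R = "ruelle T (\<lambda>x. \<beta> * G \<beta> x) ?v"
  have B: "?B \<in> sets borel" using open_image_T by auto
  have R: "exp (\<beta> * c) * indicator ?B z \<le> ?R z" for z
  proof (cases "z \<in> ?B")
    case True
    then obtain y where y: "y \<in> ball x r" "T y = z" by auto
    have "exp (\<beta> * c) \<le> ?v y * exp (\<beta> * G \<beta> y)"
      using c[of y] y assms(1,2) v(4)[OF y(1)] by auto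
    also have "\<dots> \<le> ?R z" unfolding ruelle_def using y v finite_fibre by (intro member_le_sum) auto
    finally show ?thesis using True by simp
  next
    case False
    then show ?thesis unfolding ruelle_def using v by (auto intro!: sum_nonneg)
  qed
  have "exp (\<beta> * c) * measure (\<mu> \<beta>) ?B = (\<integral>z. exp (\<beta> * c) * (u \<beta> z * indicator ?B z) \<partial>m \<beta>)"
    by (simp add: measure_mu(1)[OF assms(1) B])
  also have "\<dots> \<le> (\<integral>z. u \<beta> z * ?R z \<partial>m \<beta>)"
  proof (intro integral_mono integrable_mult_right measure_mu(2) transfer_identity(1) assms(1) B v)
    show "exp (\<beta> * c) * (u \<beta> z * indicator ?B z) \<le> u \<beta> z * ?R z" for z
      using mult_left_mono[OF R[of z], of "u \<beta> z"] u_pos[OF assms(1), of z] by (simp add: mult_ac)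
  qed
  also have "\<dots> = (\<integral>z. u \<beta> z * ?v z \<partial>m \<beta>)" by (intro transfer_identity assms(1) v)
  also have "\<dots> \<le> (\<integral>z. u \<beta> z * indicator (cball x (2 * r)) z \<partial>m \<beta>)"
  proof (intro integral_mono measure_mu(2) assms(1) m.integrable_continuous continuous_intros u_continuous v)
    show "u \<beta> z * ?v z \<le> u \<beta> z * indicator (cball x (2 * r)) z" for z
      using v(3,5)[of z] u_pos[OF assms(1), of z] by (intro mult_left_mono) (auto split: split_indicator)
  qed auto
  also have "\<dots> = measure (\<mu> \<beta>) (cball x (2 * r))" by (simp add: measure_mu(1)[OF assms(1)])
  finally show ?thesis .
qed

lemma closed_image_cball: "closed (T ` cball x r)"
proof -
  have "compact (cball x r)" using compact_space by (metis closed_cball compact_Int_closed inf_top_left)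
  then show ?thesis
    using compact_continuous_image continuous_on_subset[OF continuous_T] compact_imp_closed by blast
qed

text \<open>The other half of the Jacobian formula: \<open>T\<close> is injective on the larger ball, so at most one
  preimage contributes.\<close>

lemma measure_ball_le:
  assumes "\<beta> > 0" "r > 0" "2 * r \<le> eta" and c: "\<And>y. y \<in> cball x (2 * r) \<Longrightarrow> G \<beta> y \<le> c"
  shows "measure (\<mu> \<beta>) (ball x r) \<le> exp (\<beta> * c) * measure (\<mu> \<beta>) (T ` cball x (2 * r))"
proof -
  let ?v = "bump x r" and ?K = "T ` cball x (2 * r)"
  note v = bump[OF assms(2), where x = x]
  let ?R = "ruelle T (\<lambda>x. \<beta> * G \<beta> x) ?v"
  have K: "?K \<in> sets borel" using closed_image_cball by auto
  have R: "?R z \<le> exp (\<beta> * c) * indicator ?K z" for z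
  proof (cases "z \<in> ?K")
    case True
    then obtain y where y: "y \<in> cball x (2 * r)" "T y = z" by auto
    have "?v y' * exp (\<beta> * G \<beta> y') = 0" if "y' \<in> T -` {z} - {y}" for y'
    proof -
      have "y' \<notin> cball x (2 * r)"
      proof
        assume "y' \<in> cball x (2 * r)"
        then have "dist y y' \<le> 2 * eta" using y(1) assms(3) dist_triangle3[of y y' x] by simp
        then show False using that y(2) inj_at_small_scale[of y y'] by auto
      qed
      then show ?thesis using v by simp
    qed
    then have "?R z = (\<Sum>y'\<in>{y}. ?v y' * exp (\<beta> * G \<beta> y'))"
      unfolding ruelle_def using y(2) finite_fibre by (intro sum.mono_neutral_right) auto
    also have "\<dots> = ?v y * exp (\<beta> * G \<beta> y)" by simp
    also have "\<dots> \<le> 1 * exp (\<beta> * c)"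
      using y c[of y] v assms(1) by (intro mult_mono) auto
    finally show ?thesis using True by simp
  next
    case False
    then have "?v y = 0" if "T y = z" for y using that by (intro v(5)) auto
    then show ?thesis unfolding ruelle_def using False by simp
  qed
  have "measure (\<mu> \<beta>) (ball x r) = (\<integral>z. u \<beta> z * indicator (ball x r) z \<partial>m \<beta>)"
    by (simp add: measure_mu(1)[OF assms(1)])
  also have "\<dots> \<le> (\<integral>z. u \<beta> z * ?v z \<partial>m \<beta>)"
  proof (intro integral_mono measure_mu(2) assms(1) m.integrable_continuous continuous_intros u_continuous v)
    show "u \<beta> z * indicator (ball x r) z \<le> u \<beta> z * ?v z" for z
      using v(2,4)[of z] u_pos[OF assms(1), of z] by (intro mult_left_mono) (auto split: split_indicator)
  qed auto
  also have "\<dots> = (\<integral>z. u \<beta> z * ?R z \<partial>m \<beta>)" by (intro transfer_identity(2)[symmetric] assms(1) v)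
  also have "\<dots> \<le> (\<integral>z. exp (\<beta> * c) * (u \<beta> z * indicator ?K z) \<partial>m \<beta>)"
  proof (intro integral_mono integrable_mult_right measure_mu(2) transfer_identity(1) assms(1) K v)
    show "u \<beta> z * ?R z \<le> exp (\<beta> * c) * (u \<beta> z * indicator ?K z)" for z
      using mult_left_mono[OF R[of z], of "u \<beta> z"] u_pos[OF assms(1), of z] by (simp add: mult_ac)
  qed
  also have "\<dots> = exp (\<beta> * c) * measure (\<mu> \<beta>) ?K" by (simp add: measure_mu(1)[OF assms(1) K])
  finally show ?thesis .
qed

section \<open>The rate function determines the limit of the normalized potentials\<close>

text \<open>A single radius serves all \<open>\<beta>\<close>: this is where equicontinuity of the normalized potentials enters
  the comparison of the mass of a ball with that of its image.\<close>

lemma small_ball: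
  assumes "e > 0" "open S" "x \<in> S"
  obtains r where "0 < r" "2 * r \<le> eta" "cball x (2 * r) \<subseteq> S"
    "\<And>\<beta> y. \<beta> > 0 \<Longrightarrow> y \<in> cball x (2 * r) \<Longrightarrow> \<bar>G \<beta> x - G \<beta> y\<bar> \<le> e"
proof -
  obtain d where d: "d > 0" "\<And>\<beta> x y. \<beta> > 0 \<Longrightarrow> dist x y < d \<Longrightarrow> \<bar>G \<beta> x - G \<beta> y\<bar> \<le> e"
    using G_modulus[OF assms(1)] by blast
  obtain t where t: "t > 0" "ball x t \<subseteq> S" using assms(2,3) openE by blast
  \<comment> \<open>A quarter makes the closed ball of radius \<open>2 * r\<close> lie in the open balls of radius \<open>d\<close> and
    \<open>t\<close>.\<close>
  define r where "r = min (min d t) eta / 4"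
  have r: "0 < r" "2 * r < d" "2 * r < t" "2 * r \<le> eta" using d t eta_pos by (auto simp: r_def)
  show thesis
  proof (rule that[of r])
    show "cball x (2 * r) \<subseteq> S" using r t by (auto simp: subset_iff)
  qed (use r d in auto)
qed

text \<open>If the image of a small ball has mass at least \<open>exp (- \<beta> a)\<close> while the ball itself has mass at most
  about \<open>exp (- \<beta> c)\<close>, then the Jacobian \<open>exp (- \<beta> G(x))\<close> is at least about
  \<open>exp (\<beta> (c - a))\<close>.\<close>

lemma eventually_G_le:
  assumes I: "exponential_bounds \<mu> I"
    and a: "I (T x) < ereal a" and c: "ereal c < I x" and "e > 0"
  shows "\<forall>\<^sub>F \<beta> in at_top. G \<beta> x \<le> a - c + e"
proof -
  have "open {y. ereal c < I y}"
    using exponential_boundsD(1)[OF I] by (simp add: lower_semicontinuous_def)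
  moreover have "e / 2 > 0" "x \<in> {y. ereal c < I y}" using \<open>e > 0\<close> c by auto
  ultimately obtain r where r: "0 < r" "2 * r \<le> eta" "cball x (2 * r) \<subseteq> {y. ereal c < I y}"
    "\<And>\<beta> y. \<beta> > 0 \<Longrightarrow> y \<in> cball x (2 * r) \<Longrightarrow> \<bar>G \<beta> x - G \<beta> y\<bar> \<le> e / 2"
    using small_ball by metis
  have "\<forall>\<^sub>F \<beta> in at_top. exp (\<beta> * - a) \<le> measure (\<mu> \<beta>) (T ` ball x r)"
    using r(1) a by (intro exponential_boundsD(3)[OF I _ _ a] open_image_T) auto
  moreover have "\<forall>\<^sub>F \<beta> in at_top. measure (\<mu> \<beta>) (cball x (2 * r)) \<le> exp (\<beta> * - (c - e / 2))"
    using r(3) \<open>e > 0\<close> by (intro exponential_boundsD(4)[OF I, of _ c]) (auto intro: less_imp_le)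
  ultimately show ?thesis using eventually_gt_at_top[of 0]
  proof eventually_elim
    case (elim \<beta>)
    have near: "G \<beta> x - e / 2 \<le> G \<beta> y" if "y \<in> cball x (2 * r)" for y
      using r(4)[OF elim(3) that] by linarith
    have "exp (\<beta> * (G \<beta> x - e / 2)) * exp (\<beta> * - a)
        \<le> exp (\<beta> * (G \<beta> x - e / 2)) * measure (\<mu> \<beta>) (T ` ball x r)"
      using elim by (intro mult_left_mono) auto
    also have "\<dots> \<le> measure (\<mu> \<beta>) (cball x (2 * r))"
      using r(1) near by (intro measure_image_ball_le elim(3)) auto
    also have "\<dots> \<le> exp (\<beta> * - (c - e / 2))" by (rule elim)
    finally have "\<beta> * (G \<beta> x - e / 2 - a) \<le> \<beta> * (e / 2 - c)"
      by (simp add: mult_exp_exp algebra_simps)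
    then show ?case using elim(3) by simp
  qed
qed

text \<open>The reverse comparison: the ball has mass at least \<open>exp (- \<beta> a)\<close> and its image at most about
  \<open>exp (- \<beta> c)\<close>, so the Jacobian is at most about \<open>exp (\<beta> (a - c))\<close>.\<close>

lemma eventually_G_ge:
  assumes I: "exponential_bounds \<mu> I"
    and a: "I x < ereal a" and c: "ereal c < I (T x)" and "e > 0"
  shows "\<forall>\<^sub>F \<beta> in at_top. c - a - e \<le> G \<beta> x"
proof -
  have "open {y. ereal c < I y}"
    using exponential_boundsD(1)[OF I] by (simp add: lower_semicontinuous_def)
  then have "open (T -` {y. ereal c < I y})" using continuous_T by (intro open_vimage)
  moreover have "e / 2 > 0" "x \<in> T -` {y. ereal c < I y}" using \<open>e > 0\<close> c by auto
  ultimately obtain r where r: "0 < r" "2 * r \<le> eta" "cball x (2 * r) \<subseteq> T -` {y. ereal c < I y}"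
    "\<And>\<beta> y. \<beta> > 0 \<Longrightarrow> y \<in> cball x (2 * r) \<Longrightarrow> \<bar>G \<beta> x - G \<beta> y\<bar> \<le> e / 2"
    using small_ball by metis
  have "\<forall>\<^sub>F \<beta> in at_top. exp (\<beta> * - a) \<le> measure (\<mu> \<beta>) (ball x r)"
    using r(1) a by (intro exponential_boundsD(3)[OF I _ _ a]) auto
  moreover have "\<forall>\<^sub>F \<beta> in at_top. measure (\<mu> \<beta>) (T ` cball x (2 * r)) \<le> exp (\<beta> * - (c - e / 2))"
    using r(3) \<open>e > 0\<close>
    by (intro exponential_boundsD(4)[OF I closed_image_cball, of _ _ c]) (auto intro: less_imp_le)
  ultimately show ?thesis using eventually_gt_at_top[of 0]
  proof eventually_elim
    case (elim \<beta>)
    have near: "G \<beta> y \<le> G \<beta> x + e / 2" if "y \<in> cball x (2 * r)" for y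
      using r(4)[OF elim(3) that] by linarith
    have "exp (\<beta> * - a) \<le> measure (\<mu> \<beta>) (ball x r)" by (rule elim)
    also have "\<dots> \<le> exp (\<beta> * (G \<beta> x + e / 2)) * measure (\<mu> \<beta>) (T ` cball x (2 * r))"
      using r(1,2) near by (intro measure_ball_le elim(3)) auto
    also have "\<dots> \<le> exp (\<beta> * (G \<beta> x + e / 2)) * exp (\<beta> * - (c - e / 2))"
      using elim by (intro mult_left_mono) auto
    finally have "\<beta> * (c - a - e) \<le> \<beta> * G \<beta> x"
      by (simp add: mult_exp_exp algebra_simps)
    then show ?case using elim(3) by simp
  qed
qed

text \<open>Otherwise the mass near \<open>x\<close> would decay at every exponential rate but the mass near \<open>T x\<close> would
  not, contrary to the bound on the Jacobian.\<close>

lemma rate_finite_preimage: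
  assumes I: "exponential_bounds \<mu> I" and fin: "I (T x) < \<infinity>"
  shows "I x < \<infinity>"
proof (rule ccontr)
  assume "\<not> ?thesis"
  then have inf: "I x = \<infinity>" by simp
  obtain a where a: "I (T x) < ereal a" using fin less_PInf_Ex_of_nat by auto
  obtain C where C: "\<And>\<beta> x. \<beta> \<ge> 1 \<Longrightarrow> \<bar>G \<beta> x\<bar> \<le> C" using G_bounded by blast
  \<comment> \<open>The threshold \<open>a + C + 2\<close> pushes \<open>G\<close> below \<open>- C\<close>.\<close>
  have "\<forall>\<^sub>F \<beta> in at_top. G \<beta> x \<le> a - (a + C + 2) + 1"
    using a inf by (intro eventually_G_le[OF I]) auto
  with eventually_ge_at_top[of 1] have "\<forall>\<^sub>F \<beta>::real in at_top. False"
  proof eventually_elim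
    case (elim \<beta>)
    then show ?case using C[of \<beta> x] by linarith
  qed
  then show False by simp
qed

lemma rate_finite_image:
  assumes I: "exponential_bounds \<mu> I" and fin: "I x < \<infinity>"
  shows "I (T x) < \<infinity>"
proof (rule ccontr)
  assume "\<not> ?thesis"
  then have inf: "I (T x) = \<infinity>" by simp
  obtain a where a: "I x < ereal a" using fin less_PInf_Ex_of_nat by auto
  obtain C where C: "\<And>\<beta> x. \<beta> \<ge> 1 \<Longrightarrow> \<bar>G \<beta> x\<bar> \<le> C" using G_bounded by blast
  have "\<forall>\<^sub>F \<beta> in at_top. (a + C + 2) - a - 1 \<le> G \<beta> x"
    using a inf by (intro eventually_G_ge[OF I]) auto
  with eventually_ge_at_top[of 1] have "\<forall>\<^sub>F \<beta>::real in at_top. False"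
  proof eventually_elim
    case (elim \<beta>)
    then show ?case using C[of \<beta> x] by linarith
  qed
  then show False by simp
qed

lemma G_tendsto_at_finite_rate:
  assumes I: "exponential_bounds \<mu> I" and fin: "I x < \<infinity>"
  shows "((\<lambda>\<beta>. G \<beta> x) \<longlongrightarrow> real_of_ereal (I (T x)) - real_of_ereal (I x)) at_top"
proof -
  define i j where "i = real_of_ereal (I x)" and "j = real_of_ereal (I (T x))"
  have ij: "I x = ereal i" "I (T x) = ereal j"
    using fin rate_finite_image[OF I fin] exponential_boundsD(2)[OF I, of x]
      exponential_boundsD(2)[OF I, of "T x"]
    by (auto simp: i_def j_def ereal_real)
  have "((\<lambda>\<beta>. G \<beta> x) \<longlongrightarrow> j - i) at_top"
  proof (rule tendstoI)
    fix e :: real assume "e > 0"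
    have "\<forall>\<^sub>F \<beta> in at_top. G \<beta> x \<le> (j + e / 4) - (i - e / 4) + e / 4"
      using \<open>e > 0\<close> by (intro eventually_G_le[OF I]) (auto simp: ij)
    moreover have "\<forall>\<^sub>F \<beta> in at_top. (j - e / 4) - (i + e / 4) - e / 4 \<le> G \<beta> x"
      using \<open>e > 0\<close> by (intro eventually_G_ge[OF I]) (auto simp: ij)
    ultimately show "\<forall>\<^sub>F \<beta> in at_top. dist (G \<beta> x) (j - i) < e"
    proof eventually_elim
      case (elim \<beta>)
      then show ?case using \<open>e > 0\<close> unfolding dist_real_def abs_less_iff by (simp add: field_simps)
    qed
  qed
  then show ?thesis by (simp add: i_def j_def)
qed

lemma G_uniform_limit:
  assumes I: "exponential_bounds \<mu> I"
  shows "\<exists>g. uniform_limit UNIV G g at_top"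
proof -
  define D where "D = {x. I x < \<infinity>}"
  obtain x a where xa: "I x < ereal a" using mu.rate_function_finite_somewhere[OF I] by blast
  have "I x < \<infinity>" by (rule less_trans[OF xa]) simp
  then have "D \<noteq> {}" by (auto simp: D_def)
  moreover have "T x \<in> D \<Longrightarrow> x \<in> D" for x using rate_finite_preimage[OF I] by (simp add: D_def)
  ultimately have dense: "closure D = UNIV" by (rule backward_invariant_set_dense)
  show ?thesis
  proof (rule equicontinuous_uniform_limit[where start = 1])
    show "UNIV \<subseteq> closure D" using dense by simp
    fix e :: real assume "e > 0"
    then show "\<exists>d>0. \<forall>\<beta>\<ge>1. \<forall>x\<in>UNIV. \<forall>y\<in>UNIV. dist x y < d \<longrightarrow> \<bar>G \<beta> x - G \<beta> y\<bar> \<le> e"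
      using G_modulus[of e] by (metis less_le_trans zero_less_one)
  next
    show "\<exists>l. ((\<lambda>\<beta>. G \<beta> x) \<longlongrightarrow> l) at_top" if "x \<in> D" for x
      using G_tendsto_at_finite_rate[OF I, of x] that by (auto simp: D_def)
  qed (use compact_space in auto)
qed

section \<open>Convergence of the eigenfunctions\<close>

text \<open>The difference \<open>D\<close> of two \<open>W\<close> satisfies \<open>D - D \<circ> T = q\<close> up to \<open>\<delta>\<close>, with \<open>q\<close> the difference
  of the scaled pressures. At a minimum of \<open>D\<close> the left-hand side is at most \<open>0\<close>, at a maximum it
  is at least \<open>0\<close>; so \<open>\<bar>q\<bar> \<le> \<delta>\<close>.\<close>

lemma W_difference_almost_invariant:
  assumes "\<beta> > 0" "\<gamma> > 0" and close: "\<And>x. \<bar>G \<beta> x - G \<gamma> x\<bar> \<le> \<delta>"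
  shows "\<bar>(W \<beta> x - W \<gamma> x) - (W \<beta> (T x) - W \<gamma> (T x))\<bar> \<le> 2 * \<delta>"
proof -
  define D where "D x = W \<beta> x - W \<gamma> x" for x
  define q where "q = P \<beta> / \<beta> - P \<gamma> / \<gamma>"
  have D: "continuous_on UNIV D"
    unfolding D_def using assms by (intro continuous_intros W_continuous)
  have eq: "G \<beta> x - G \<gamma> x = D x - D (T x) - q" for x
    unfolding G_eq[OF assms(1)] G_eq[OF assms(2)] D_def q_def by simp
  obtain y where "\<And>z. D y \<le> D z" using continuous_attains_inf[OF compact_space _ D] by auto
  then have "q \<le> \<delta>" using eq[of y] close[of y] by (smt (verit))
  obtain y where "\<And>z. D z \<le> D y" using continuous_attains_sup[OF compact_space _ D] by auto
  then have "- \<delta> \<le> q" using eq[of y] close[of y] by (smt (verit))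
  then show ?thesis using \<open>q \<le> \<delta>\<close> eq[of x] close[of x] unfolding D_def by linarith
qed

text \<open>An equicontinuous function that changes little along orbits is almost constant: any two points
  are joined by an orbit segment whose length \<open>N\<close> depends only on the modulus of continuity. Since
  that modulus is shared by all \<open>\<beta>\<close>, \<open>N\<close> can be fixed before \<open>\<delta>\<close>.\<close>

lemma W_centered_uniform_limit:
  assumes "uniform_limit UNIV G g at_top"
  shows "\<exists>V. uniform_limit UNIV (\<lambda>\<beta> x. W \<beta> x - W \<beta> x0) V at_top"
proof (rule uniform_limit_if_uniformly_Cauchy)
  fix e :: real assume "e > 0"
  then obtain d where d: "d > 0"
      "\<And>\<beta> x y. \<beta> > 0 \<Longrightarrow> dist x y < d \<Longrightarrow> \<bar>W \<beta> x - W \<beta> y\<bar> \<le> e / 8"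
    using W_modulus[of "e / 8"] by auto
  obtain N where N: "\<And>x y. \<exists>n\<le>N. \<exists>z. dist x z < d \<and> dist ((T ^^ n) z) y < d"
    using uniform_transitivity[OF d(1)] by blast
  \<comment> \<open>Chosen so that at most \<open>N\<close> steps along an orbit change the difference by at most
    \<open>e / 2\<close>.\<close>
  define \<delta> where "\<delta> = e / (4 * (real N + 1))"
  have \<delta>: "\<delta> > 0" "2 * real N * \<delta> \<le> e / 2" using \<open>e > 0\<close> by (auto simp: \<delta>_def field_simps)
  have "\<forall>\<^sub>F \<beta> in at_top. \<forall>x\<in>UNIV. dist (G \<beta> x) (g x) < \<delta> / 2"
    using \<delta> assms by (intro uniform_limitD) auto
  with eventually_gt_at_top[of 0]
  have "\<forall>\<^sub>F \<beta> in at_top. 0 < \<beta> \<and> (\<forall>x. dist (G \<beta> x) (g x) < \<delta> / 2)" by eventually_elim simp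
  then obtain b where b: "\<And>\<beta>. \<beta> \<ge> b \<Longrightarrow> 0 < \<beta>" "\<And>\<beta> x. \<beta> \<ge> b \<Longrightarrow> dist (G \<beta> x) (g x) < \<delta> / 2"
    unfolding eventually_at_top_linorder by blast
  show "\<exists>b. \<forall>\<beta>\<ge>b. \<forall>\<gamma>\<ge>b. \<forall>x\<in>UNIV. \<bar>(W \<beta> x - W \<beta> x0) - (W \<gamma> x - W \<gamma> x0)\<bar> \<le> e"
  proof (intro exI[of _ b] allI impI ballI)
    fix \<beta> \<gamma> x assume *: "b \<le> \<beta>" "b \<le> \<gamma>"
    define D where "D x = W \<beta> x - W \<gamma> x" for x
    have pos: "\<beta> > 0" "\<gamma> > 0" using b * by auto
    have "\<bar>G \<beta> x - G \<gamma> x\<bar> \<le> \<delta>" for x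
      using b(2)[OF *(1), of x] b(2)[OF *(2), of x] unfolding dist_real_def by linarith
    then have step: "\<bar>D x - D (T x)\<bar> \<le> 2 * \<delta>" for x
      unfolding D_def by (rule W_difference_almost_invariant[OF pos])
    have steps: "\<bar>D x - D ((T ^^ n) x)\<bar> \<le> 2 * real n * \<delta>" for x n
    proof (induction n)
      case (Suc n)
      then show ?case using step[of "(T ^^ n) x"] by (simp add: algebra_simps)
    qed simp
    have small: "\<bar>D x - D y\<bar> \<le> e / 4" if "dist x y < d" for x y
      using d(2)[OF pos(1) that] d(2)[OF pos(2) that] unfolding D_def by linarith
    obtain n z where z: "n \<le> N" "dist x z < d" "dist ((T ^^ n) z) x0 < d" using N by blast
    have "2 * real n * \<delta> \<le> 2 * real N * \<delta>" using z(1) \<delta>(1) by simp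
    then have "\<bar>D x - D x0\<bar> \<le> e"
      using small[OF z(2)] small[OF z(3)] steps[of z n] \<delta>(2) by linarith
    then show "\<bar>(W \<beta> x - W \<beta> x0) - (W \<gamma> x - W \<gamma> x0)\<bar> \<le> e" unfolding D_def by linarith
  qed
qed

lemma mgf_m_eq_mgf_mu:
  assumes "\<beta> > 0" "continuous_on UNIV f"
  shows "scaled_log_mgf m \<beta> f = scaled_log_mgf \<mu> \<beta> (\<lambda>x. f x - W \<beta> x)"
proof -
  have "continuous_on UNIV (\<lambda>x. exp (\<beta> * (f x - W \<beta> x)))"
    using assms by (intro continuous_intros W_continuous)
  then have "(\<integral>x. exp (\<beta> * (f x - W \<beta> x)) \<partial>\<mu> \<beta>) = (\<integral>x. u \<beta> x * exp (\<beta> * (f x - W \<beta> x)) \<partial>m \<beta>)"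
    by (intro integral_mu assms borel_measurable_continuous_onI)
  also have "\<dots> = (\<integral>x. exp (\<beta> * f x) \<partial>m \<beta>)"
    using assms(1) by (intro Bochner_Integration.integral_cong)
      (auto simp: right_diff_distrib exp_diff exp_W u_pos less_imp_neq[symmetric])
  finally show ?thesis by (simp add: scaled_log_mgf_def)
qed

text \<open>The additive constant \<open>W(x0)\<close> is recovered from \<open>\<integral> exp (- \<beta> W) d\<mu> = 1\<close>: it equals the
  Laplace functional of \<open>\<mu>\<close> at \<open>- (W - W(x0))\<close>, which converges by Varadhan's lemma because the
  centred functions converge uniformly.\<close>

lemma W_uniform_limit:
  assumes I: "exponential_bounds \<mu> I" and g: "uniform_limit UNIV G g at_top"
  shows "\<exists>V. uniform_limit UNIV W V at_top"
proof -
  fix x0 :: 'a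
  obtain V where V: "uniform_limit UNIV (\<lambda>\<beta> x. W \<beta> x - W \<beta> x0) V at_top"
    using W_centered_uniform_limit[OF g] by blast
  have cont: "continuous_on UNIV (\<lambda>x. W \<beta> x - W \<beta> x0)" if "\<beta> > 0" for \<beta>
    using that by (intro continuous_intros W_continuous)
  have "continuous_on UNIV V" using cont V by (rule continuous_on_uniform_limit_at_top)
  then have nV: "continuous_on UNIV (\<lambda>x. - V x)" by (intro continuous_intros)
  obtain L where L: "((\<lambda>\<beta>. scaled_log_mgf \<mu> \<beta> (\<lambda>x. - V x)) \<longlongrightarrow> L) at_top"
    using mu.varadhan[OF I nV] by blast
  have "((\<lambda>\<beta>. scaled_log_mgf \<mu> \<beta> (\<lambda>x. - (W \<beta> x - W \<beta> x0))) \<longlongrightarrow> L) at_top"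
    using cont by (intro mu.scaled_log_mgf_uniform_limit[OF L _ nV] uniform_limit_uminus V continuous_on_minus)
  moreover have "\<forall>\<^sub>F \<beta> in at_top. scaled_log_mgf \<mu> \<beta> (\<lambda>x. - (W \<beta> x - W \<beta> x0)) = W \<beta> x0"
    using eventually_gt_at_top[of 0]
  proof eventually_elim
    case (elim \<beta>)
    interpret prob_space "m \<beta>" using m.is_prob elim by auto
    have "scaled_log_mgf \<mu> \<beta> (\<lambda>x. 0 - W \<beta> x) = scaled_log_mgf m \<beta> (\<lambda>x. 0)"
      using elim by (intro mgf_m_eq_mgf_mu[symmetric]) auto
    also have "\<dots> = 0" by (simp add: scaled_log_mgf_def prob_space)
    finally have 0: "scaled_log_mgf \<mu> \<beta> (\<lambda>x. - W \<beta> x) = 0" by simp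
    have c: "continuous_on UNIV (\<lambda>x. - W \<beta> x)" "continuous_on UNIV (\<lambda>x. - (W \<beta> x - W \<beta> x0))"
      using elim by (auto intro!: continuous_intros W_continuous)
    show ?case
      using mu.scaled_log_mgf_mono[OF elim c, of "- W \<beta> x0"] mu.scaled_log_mgf_mono[OF elim c(2,1), of "W \<beta> x0"] 0
      by simp
  qed
  ultimately have "((\<lambda>\<beta>. W \<beta> x0) \<longlongrightarrow> L) at_top" by (rule Lim_transform_eventually)
  then have "uniform_limit UNIV (\<lambda>\<beta> x. W \<beta> x0) (\<lambda>x. L) at_top"
    by (auto intro!: uniform_limitI dest: tendstoD)
  from uniform_limit_add[OF V this] show ?thesis by auto
qed

section \<open>Laplace functionals of the eigenmeasures\<close>

lemma log_laplace_eq: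
  "\<beta> > 0 \<Longrightarrow> log_laplace m \<beta> f = scaled_log_mgf \<mu> \<beta> (\<lambda>x. apply_bcontfun f x - W \<beta> x)"
  by (subst mgf_m_eq_mgf_mu[symmetric])
     (auto simp: log_laplace_def scaled_log_mgf_def intro: continuous_on_apply_bcontfun)

lemma log_laplace_lipschitz:
  assumes "\<beta> > 0"
  shows "\<bar>log_laplace m \<beta> f - log_laplace m \<beta> h\<bar> \<le> dist f h"
proof -
  have "\<bar>scaled_log_mgf m \<beta> (apply_bcontfun f) - scaled_log_mgf m \<beta> (apply_bcontfun h)\<bar> \<le> dist f h"
    using dist_bounded[of f _ h] assms
    by (intro m.scaled_log_mgf_lipschitz continuous_on_apply_bcontfun) (auto simp: dist_real_def)
  then show ?thesis by (simp add: log_laplace_def scaled_log_mgf_def)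
qed

text \<open>Pointwise convergence on \<open>C(X)\<close> is Varadhan's lemma for \<open>\<mu>\<close> at \<open>f - W\<close>; the Lipschitz bound makes it
  uniform on compact sets.\<close>

lemma log_laplace_uniform_limit:
  assumes I: "exponential_bounds \<mu> I" and V: "uniform_limit UNIV W V at_top"
  shows "\<exists>L. \<forall>K :: ('a \<Rightarrow>\<^sub>C real) set. compact K \<longrightarrow> uniform_limit K (log_laplace m) L at_top"
proof -
  have cV: "continuous_on UNIV V" using W_continuous V by (rule continuous_on_uniform_limit_at_top)
  have "\<exists>l. ((\<lambda>\<beta>. log_laplace m \<beta> f) \<longlongrightarrow> l) at_top" for f
  proof -
    have cf: "continuous_on UNIV (apply_bcontfun f)" by simp
    have c: "continuous_on UNIV (\<lambda>x. apply_bcontfun f x - V x)" using cf cV by (intro continuous_intros)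
    obtain l where l: "((\<lambda>\<beta>. scaled_log_mgf \<mu> \<beta> (\<lambda>x. apply_bcontfun f x - V x)) \<longlongrightarrow> l) at_top"
      using mu.varadhan[OF I c] by blast
    have "((\<lambda>\<beta>. scaled_log_mgf \<mu> \<beta> (\<lambda>x. apply_bcontfun f x - W \<beta> x)) \<longlongrightarrow> l) at_top"
      by (intro mu.scaled_log_mgf_uniform_limit[OF l _ c] uniform_limit_minus uniform_limit_const V
          continuous_on_diff cf W_continuous)
    moreover have "\<forall>\<^sub>F \<beta> in at_top. scaled_log_mgf \<mu> \<beta> (\<lambda>x. apply_bcontfun f x - W \<beta> x) = log_laplace m \<beta> f"
      using eventually_gt_at_top[of 0] by eventually_elim (simp add: log_laplace_eq)
    ultimately have "((\<lambda>\<beta>. log_laplace m \<beta> f) \<longlongrightarrow> l) at_top"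
      by (rule Lim_transform_eventually)
    then show ?thesis by blast
  qed
  then obtain L where L: "\<And>f. ((\<lambda>\<beta>. log_laplace m \<beta> f) \<longlongrightarrow> L f) at_top" by metis
  have "uniform_limit K (log_laplace m) L at_top" if "compact K" for K
  proof -
    have "\<exists>h. uniform_limit K (log_laplace m) h at_top"
    proof (rule equicontinuous_uniform_limit[where start = 1])
      fix e :: real assume "e > 0"
      then show "\<exists>d>0. \<forall>\<beta>\<ge>1. \<forall>f\<in>K. \<forall>h\<in>K. dist f h < d \<longrightarrow> \<bar>log_laplace m \<beta> f - log_laplace m \<beta> h\<bar> \<le> e"
        by (intro exI[of _ e] conjI allI ballI impI order_trans[OF log_laplace_lipschitz]) auto
    qed (use that L closure_subset in auto)
    then obtain h where h: "uniform_limit K (log_laplace m) h at_top" by blast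
    have "h f = L f" if "f \<in> K" for f
      using tendsto_uniform_limitI[OF h that] L by (rule tendsto_unique[OF trivial_limit_at_top_linorder])
    then show ?thesis using h uniform_limit_cong'[of K "log_laplace m" "log_laplace m" h L at_top] by simp
  qed
  then show ?thesis by blast
qed

text \<open>The Laplace functional of \<open>\<mu>\<close> at \<open>f\<close> is that of \<open>m\<close> at \<open>f + W\<close>, and \<open>f + W\<close> may be replaced by its
  uniform limit \<open>f + V\<close>, a function independent of \<open>\<beta>\<close>.\<close>

lemma ldp_if_uniform_limits:
  assumes V: "uniform_limit UNIV W V at_top"
    and L: "\<And>f. ((\<lambda>\<beta>. log_laplace m \<beta> f) \<longlongrightarrow> L f) at_top"
  shows "large_deviation_principle \<mu>"
proof (rule mu.bryc)
  fix f :: "'a \<Rightarrow> real" assume f: "continuous_on UNIV f"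
  have cV: "continuous_on UNIV V" using W_continuous V by (rule continuous_on_uniform_limit_at_top)
  then have c: "continuous_on UNIV (\<lambda>x. f x + V x)" using f by (intro continuous_intros)
  have "bounded (range (\<lambda>x. f x + V x))"
    using compact_space c compact_continuous_image compact_imp_bounded by blast
  then have "(\<lambda>x. f x + V x) \<in> bcontfun" using c by (simp add: bcontfun_def)
  then have ap: "apply_bcontfun (Bcontfun (\<lambda>x. f x + V x)) = (\<lambda>x. f x + V x)"
    by (rule Bcontfun_inverse)
  have lim: "((\<lambda>\<beta>. scaled_log_mgf m \<beta> (\<lambda>x. f x + V x)) \<longlongrightarrow> L (Bcontfun (\<lambda>x. f x + V x))) at_top"
    using L[of "Bcontfun (\<lambda>x. f x + V x)"] by (simp add: log_laplace_def scaled_log_mgf_def ap)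
  have "((\<lambda>\<beta>. scaled_log_mgf m \<beta> (\<lambda>x. f x + W \<beta> x)) \<longlongrightarrow> L (Bcontfun (\<lambda>x. f x + V x))) at_top"
    by (intro m.scaled_log_mgf_uniform_limit[OF lim _ c] uniform_limit_add uniform_limit_const V
        continuous_on_add f W_continuous)
  moreover have "\<forall>\<^sub>F \<beta> in at_top. scaled_log_mgf m \<beta> (\<lambda>x. f x + W \<beta> x) = scaled_log_mgf \<mu> \<beta> f"
    using eventually_gt_at_top[of 0]
  proof eventually_elim
    case (elim \<beta>)
    then have "continuous_on UNIV (\<lambda>x. f x + W \<beta> x)" by (intro continuous_intros f W_continuous)
    then show ?case using mgf_m_eq_mgf_mu[OF elim] by simp
  qed
  ultimately have "((\<lambda>\<beta>. scaled_log_mgf \<mu> \<beta> f) \<longlongrightarrow> L (Bcontfun (\<lambda>x. f x + V x))) at_top"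
    by (rule Lim_transform_eventually)
  then show "\<exists>L. ((\<lambda>\<beta>. scaled_log_mgf \<mu> \<beta> f) \<longlongrightarrow> L) at_top" by blast
qed

lemma ldp_iff_limits:
  "(large_deviation_principle \<mu> \<longrightarrow>
      (\<exists>g. uniform_limit UNIV G g at_top) \<and> (\<exists>V. uniform_limit UNIV W V at_top) \<and>
      (\<exists>L. \<forall>K :: ('a \<Rightarrow>\<^sub>C real) set. compact K \<longrightarrow> uniform_limit K (log_laplace m) L at_top)) \<and>
   ((\<exists>V. uniform_limit UNIV W V at_top) \<and>
    (\<exists>L. \<forall>K :: ('a \<Rightarrow>\<^sub>C real) set. compact K \<longrightarrow> uniform_limit K (log_laplace m) L at_top)
      \<longrightarrow> large_deviation_principle \<mu>)"
proof (intro conjI[of "_ \<longrightarrow> _"] impI)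
  assume "large_deviation_principle \<mu>"
  then obtain I where I: "exponential_bounds \<mu> I" by (rule exponential_bounds_if_ldp)
  obtain g where g: "uniform_limit UNIV G g at_top" using G_uniform_limit[OF I] by blast
  obtain V where V: "uniform_limit UNIV W V at_top" using W_uniform_limit[OF I g] by blast
  from g V log_laplace_uniform_limit[OF I V]
  show "(\<exists>g. uniform_limit UNIV G g at_top) \<and> (\<exists>V. uniform_limit UNIV W V at_top) \<and>
      (\<exists>L. \<forall>K :: ('a \<Rightarrow>\<^sub>C real) set. compact K \<longrightarrow> uniform_limit K (log_laplace m) L at_top)"
    by blast
next
  assume "(\<exists>V. uniform_limit UNIV W V at_top) \<and>
    (\<exists>L. \<forall>K :: ('a \<Rightarrow>\<^sub>C real) set. compact K \<longrightarrow> uniform_limit K (log_laplace m) L at_top)"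
  then obtain V L where V: "uniform_limit UNIV W V at_top"
    and L: "\<And>K :: ('a \<Rightarrow>\<^sub>C real) set. compact K \<Longrightarrow> uniform_limit K (log_laplace m) L at_top" by blast
  have "((\<lambda>\<beta>. log_laplace m \<beta> f) \<longlongrightarrow> L f) at_top" for f
    using L[of "{f}"] by simp
  with V show "large_deviation_principle \<mu>" by (rule ldp_if_uniform_limits)
qed

end

theorem theorem2:
  fixes T :: "'a::metric_space \<Rightarrow> 'a" and A :: "'a \<Rightarrow> real" and \<alpha> :: real
    and m \<mu> :: "real \<Rightarrow> 'a measure" and u :: "real \<Rightarrow> 'a \<Rightarrow> real"
  assumes "compact (UNIV :: 'a set)"
    and "expanding_covering_map T" and "topologically_transitive T"
    and "0 < \<alpha>" and "\<alpha> \<le> 1" and "holder_continuous \<alpha> A"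
    and "\<And>\<beta>. \<beta> > 0 \<Longrightarrow> ruelle_eigenmeasure T (\<lambda>x. \<beta> * A x) (m \<beta>)"
    and "\<And>\<beta>. \<beta> > 0 \<Longrightarrow> ruelle_eigenfunction T (\<lambda>x. \<beta> * A x) (m \<beta>) (u \<beta>)"
    and "\<And>\<beta>. \<beta> > 0 \<Longrightarrow> \<mu> \<beta> = density (m \<beta>) (\<lambda>x. ennreal (u \<beta> x))"
    and "\<And>\<beta>. \<beta> > 0 \<Longrightarrow> equilibrium_state T (\<lambda>x. \<beta> * A x) (\<mu> \<beta>)"
  shows "(large_deviation_principle \<mu> \<longrightarrow>
            (\<exists>g. uniform_limit UNIV
               (\<lambda>\<beta> x. normalized_potential T (\<lambda>y. \<beta> * A y) (u \<beta>) x / \<beta>) g at_top) \<and>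
            (\<exists>V. uniform_limit UNIV (\<lambda>\<beta> x. (1 / \<beta>) * ln (u \<beta> x)) V at_top) \<and>
            (\<exists>L. \<forall>K :: ('a \<Rightarrow>\<^sub>C real) set. compact K \<longrightarrow>
               uniform_limit K (log_laplace m) L at_top)) \<and>
         ((\<exists>V. uniform_limit UNIV (\<lambda>\<beta> x. (1 / \<beta>) * ln (u \<beta> x)) V at_top) \<and>
          (\<exists>L. \<forall>K :: ('a \<Rightarrow>\<^sub>C real) set. compact K \<longrightarrow>
               uniform_limit K (log_laplace m) L at_top)
            \<longrightarrow> large_deviation_principle \<mu>)"
proof -
  obtain lam eta where le: "lam > 1" "eta > 0"
      "\<And>x y. dist x y \<le> 2 * eta \<Longrightarrow> lam * dist x y \<le> dist (T x) (T y)"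
    using assms(2) unfolding expanding_covering_map_def distance_expanding_def by blast
  have cov: "covering_map T" using assms(2) by (simp add: expanding_covering_map_def)
  obtain C where C: "\<And>x y. \<bar>A x - A y\<bar> \<le> C * dist x y powr \<alpha>"
    using assms(6) unfolding holder_continuous_def by blast
  have "\<bar>A x - A y\<bar> \<le> max C 0 * dist x y powr \<alpha>" for x y
    using C[of x y] mult_right_mono[of C "max C 0" "dist x y powr \<alpha>"] by simp
  then interpret zero_temperature T lam eta A \<alpha> "max C 0" m \<mu> u
    using assms(1,3,4,7-10) le cov
    by unfold_locales
       (auto simp: covering_map_def open_map_def equilibrium_state_def invariant_prob_def)
  show ?thesis using ldp_iff_limits unfolding G_def[abs_def] W_def[abs_def] .
qed

end
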